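(* Let $(P,w)$ be a compatible pair, let $M_{P,w}$ be the $w$-th tableau graph transfer matrix of $P$, let $u_{P,w}\in\mathbb{R}^{\dim(P,w)}$ be the column vector all of whose entries equal $1$, and let $v_{P,w}\in\mathbb{R}^{\dim(P,w)}$ be the vector defined below. Then for every integer $n\ge N(P,w)$, $$P_w(n)=u_{P,w}^{T}\,M_{P,w}^{\,n-N(P,w)}\,v_{P,w},$$ where $P_w(n)=|SYT(Sh^w(P,n))|$.
   Context: Coordinates: a cell $(i,j)\in\mathbb{Z}^2$ lies in row $i$ and column $j$; rows are numbered from top to bottom and columns from left to right (English/matrix convention). $\mathbb{N}^2=\{(i,j):i,j\ge 1\}$. Addition and subtraction in $\mathbb{Z}^2$ are componentwise, and $p+S=\{p+q:q\in S\}$. A finite $S\subseteq\mathbb{Z}^2$ is connected if any two cells of $S$ are joined by a sequence of cells of $S$ in which consecutive cells differ by $(\pm1,0)$ or $(0,\pm1)$. For finite $S\subseteq\mathbb{Z}^2$, a partial tableau of shape $S$ is an injective map $\tau:S\to\mathbb{N}$ with $\tau(i,j)<\tau(i,j+1)$ whenever $(i,j),(i,j+1)\in S$ and $\tau(i,j)<\tau(i+1,j)$ whenever $(i,j),(i+1,j)\in S$; a standard Young tableau of shape $S$ is a partial tableau of shape $S$ with values in $\{1,\dots,|S|\}$; $SYT(S)$ is the set of these; a subtableau of $\tau$ is a restriction $\tau|_X$ to a subset $X\subseteq S$. Periodic shape: a finite $P\subseteq\mathbb{Z}^2$ containing $(1,1)$ which (up to translation) is a skew diagram $\lambda/\mu$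 drawn in French notation, for partitions $\lambda=(\lambda_1\ge\dots\ge\lambda_m)$, $\mu=(\mu_1\ge\dots\ge\mu_n)$ with $n\ge m$ (the $k$-th row from the bottom occupies columns $\mu_k+1,\dots,\lambda_k$), such that $P$ is connected and every column $C$ of $P$ which is neither the left-most nor the right-most column of $P$ contains a cell $(i_0,j_0)$ with $(i_0,j_0-1),(i_0,j_0+1)\in P$. For a periodic shape $P$ and integer $w\ge0$, let $a$ be the left-most cell of the top row of $P$ and $b$ the left-most cell of the bottom row of $P$; set $\nabla_wP=b-a+(1,w)$ and $Sh^w(P,m)=\bigcup_{i=0}^{m}\big(i\,\nabla_wP+P\big)$. The pair $(P,w)$ is compatible if for all $n$ the set $Sh^w(P,n)$ is a periodic shape, and the maximum number of cells in a column of $Sh^w(P,n)$ is bounded independently of $n$. Notation: for finite $X\subseteq\mathbb{Z}^2$, $\overline{X}$ denotes the translate of $X$ such that for all non-negative integers $p,q$ with $p>0$ or $q>0$, $\overline{X}-(p,q)\not\subseteq\mathbb{N}^2$ (i.e. $X$ pushed to touch the first row and first column). For finite $S$ and $v=(i_0,j_0)$, $\Delta^S v=\{(i,j)\in S: i\le i_0,\ j>j_0\}$. For $S=Sh^w(P,m)$, $v_{S,P}$ is the left-most cell of the top row of $P+(m-1)\nabla_wP$. Index and coefficient shapes: take $m$ sufficiently large, $S=Sh^w(P,m)$, and let $u$ be the cell of the bottom row of $S$ with $u-\nabla_wP=v_{S,P}-(1,0)$. Then $I(P,w)=\overline{\Delta^S u}$ and $C(P,w)=\overline{A\cup(P+(m-1)\nabla_wP)}$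 where $A=\Delta^S u\cup\Delta^S(u-\nabla_wP)$. Set $\dim(P,w)=|SYT(I(P,w))|$ and let $N(P,w)$ be the smallest $m$ such that $I(P,w)+v\subseteq Sh^w(P,m)$ for some $v\in\mathbb{Z}^2$. Tableau graph: for a partial tableau $\tau$ of shape $S$, $Tb(\tau)$ has vertex set $S$ and edge set the pairs $\{(i_1,j_1),(i_2,j_2)\}\subseteq S$ with $i_1>i_2$, $j_1<j_2$ and $\tau(i_1,j_1)<\tau(i_2,j_2)$. Two tableau graphs $G,H$ are isomorphic ($G\cong H$) if some translation $\phi$ of $\mathbb{Z}^2$ maps $V(G)$ onto $V(H)$ with $\{a,b\}\in E(G)\iff\{\phi(a),\phi(b)\}\in E(H)$. For $\tau\in SYT(C(P,w))$: the top index tableau $\tau^T$ is the subtableau of $\tau$ whose tableau graph is isomorphic to $Tb(\xi)$ for some $\xi\in SYT(I(P,w))$, whose top row is contained in the top row of $\tau$ and whose left-most column is contained in the left-most column of $\tau$; the bottom index tableau $\tau^B$ is the analogous subtableau whose bottom row lies in the bottom row of $\tau$ and whose right-most column lies in the right-most column of $\tau$. For $\tau\in SYT(Sh^w(P,m))$, the index tableau $\tau^I$ is the subtableau of $\tau$ whose tableau graph is isomorphic to $Tb(\xi)$ for some $\xi\in SYT(I(P,w))$, whose bottom row is contained in the bottom row of $\tau$ and whose right-most column is contained in the right-most column of $\tau$. Transfer matrix: $M_{P,w}$ has rows and columns indexed by $SYT(I(P,w))$ (in a fixed common order) and entries $M_{P,w}(\tau_2,\tau_1)=|\{\tau\in SYT(C(P,w)):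 Tb(\tau^T)\cong Tb(\tau_1),\ Tb(\tau^B)\cong Tb(\tau_2)\}|$. The vector $v_{P,w}$ is indexed by $SYT(I(P,w))$ (same order) with entry in position $\tau$ equal to $|\{\xi\in SYT(Sh^w(P,N(P,w))): Tb(\xi^I)\cong Tb(\tau)\}|$.
   Formalization: Δ^S v is taken with j ≥ j_0 instead of j > j_0 (with the strict inequality the top index tableau need not exist), and u is fixed by u − ∇_wP = v_{S,P} − (1,0), so it lies in the bottom row of P+(m−1)∇_wP, since no such cell lies in the bottom row of S. *)

theory Defs
  imports "HOL-Library.Product_Plus" "Jordan_Normal_Form.Matrix"
begin

text \<open>A cell \<open>(i, j)\<close> lies in row \<open>i\<close> (rows numbered from top to bottom) and column \<open>j\<close>
  (columns numbered from left to right).  Addition and subtraction of cells are componentwise.\<close>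

type_synonym cell = "int \<times> int"

definition translate :: "cell \<Rightarrow> cell set \<Rightarrow> cell set" where
  "translate t S = (\<lambda>p. t + p) ` S"

definition pos_quadrant :: "cell set" where
  "pos_quadrant = {(i, j). 1 \<le> i \<and> 1 \<le> j}"

definition top_row :: "cell set \<Rightarrow> cell set" where
  "top_row S = {p \<in> S. fst p = Min (fst ` S)}"

definition bottom_row :: "cell set \<Rightarrow> cell set" where
  "bottom_row S = {p \<in> S. fst p = Max (fst ` S)}"

definition leftmost_column :: "cell set \<Rightarrow> cell set" where
  "leftmost_column S = {p \<in> S. snd p = Min (snd ` S)}"

definition rightmost_column :: "cell set \<Rightarrow> cell set" where
  "rightmost_column S = {p \<in> S. snd p = Max (snd ` S)}"

definition topleft_cell :: "cell set \<Rightarrow> cell" where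
  "topleft_cell S = (Min (fst ` S), Min (snd ` top_row S))"

definition bottomleft_cell :: "cell set \<Rightarrow> cell" where
  "bottomleft_cell S = (Max (fst ` S), Min (snd ` bottom_row S))"

definition adjacent :: "cell \<Rightarrow> cell \<Rightarrow> bool" where
  "adjacent p q \<longleftrightarrow> q - p \<in> {(1, 0), (-1, 0), (0, 1), (0, -1)}"

definition connected_cells :: "cell set \<Rightarrow> bool" where
  "connected_cells S \<longleftrightarrow>
     (\<forall>p\<in>S. \<forall>q\<in>S. (p, q) \<in> {(x, y). x \<in> S \<and> y \<in> S \<and> adjacent x y}\<^sup>*)"


subsection \<open>Tableaux\<close>

text \<open>A tableau is a partial function on cells, its shape being its domain; the subtableau on
  \<open>X\<close> is then the restriction \<open>\<tau> |` X\<close>.\<close>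

type_synonym tableau = "cell \<rightharpoonup> nat"

definition partial_tableau :: "cell set \<Rightarrow> tableau \<Rightarrow> bool" where
  "partial_tableau S \<tau> \<longleftrightarrow> dom \<tau> = S \<and> inj_on \<tau> S \<and>
     (\<forall>i j. (i, j) \<in> S \<longrightarrow> (i, j + 1) \<in> S \<longrightarrow> the (\<tau> (i, j)) < the (\<tau> (i, j + 1))) \<and>
     (\<forall>i j. (i, j) \<in> S \<longrightarrow> (i + 1, j) \<in> S \<longrightarrow> the (\<tau> (i, j)) < the (\<tau> (i + 1, j)))"

definition SYT :: "cell set \<Rightarrow> tableau set" where
  "SYT S = {\<tau>. partial_tableau S \<tau> \<and> ran \<tau> \<subseteq> {1..card S}}"


subsection \<open>Periodic shapes\<close>

text \<open>The skew diagram in French notation; the parts are indexed from \<open>0\<close>, and the part with index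
  \<open>k\<close> gives the row with coordinate \<open>-k\<close>, so that the longest parts are at the bottom.\<close>

definition french_skew :: "nat list \<Rightarrow> nat list \<Rightarrow> cell set" where
  "french_skew lam mu =
     {(- int k, j) | k j. k < length lam \<and> int (mu ! k) + 1 \<le> j \<and> j \<le> int (lam ! k)}"

definition is_skew_diagram :: "cell set \<Rightarrow> bool" where
  "is_skew_diagram S \<longleftrightarrow>
     (\<exists>lam mu t. sorted_wrt (\<ge>) lam \<and> sorted_wrt (\<ge>) mu \<and> length lam \<le> length mu \<and>
        (\<forall>k<length lam. mu ! k \<le> lam ! k) \<and> S = translate t (french_skew lam mu))"

definition periodic_shape :: "cell set \<Rightarrow> bool" where
  "periodic_shape P \<longleftrightarrow> finite P \<and> (1, 1) \<in> P \<and> is_skew_diagram P \<and> connected_cells P \<and>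
     (\<forall>c \<in> snd ` P. c \<noteq> Min (snd ` P) \<longrightarrow> c \<noteq> Max (snd ` P) \<longrightarrow>
        (\<exists>i. (i, c) \<in> P \<and> (i, c - 1) \<in> P \<and> (i, c + 1) \<in> P))"

definition nabla :: "cell set \<Rightarrow> nat \<Rightarrow> cell" where
  "nabla P w = bottomleft_cell P - topleft_cell P + (1, int w)"

definition scale :: "nat \<Rightarrow> cell \<Rightarrow> cell" where
  "scale k p = (int k * fst p, int k * snd p)"

definition Sh :: "cell set \<Rightarrow> nat \<Rightarrow> nat \<Rightarrow> cell set" where
  "Sh P w m = (\<Union>i\<le>m. translate (scale i (nabla P w)) P)"

definition compatible :: "cell set \<Rightarrow> nat \<Rightarrow> bool" where
  "compatible P w \<longleftrightarrow> periodic_shape P \<and> (\<forall>n. periodic_shape (Sh P w n)) \<and>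
     (\<exists>B. \<forall>n c. card {p \<in> Sh P w n. snd p = c} \<le> B)"

definition num_SYT_Sh :: "cell set \<Rightarrow> nat \<Rightarrow> nat \<Rightarrow> nat" where
  "num_SYT_Sh P w n = card (SYT (Sh P w n))"


subsection \<open>Index and coefficient shapes\<close>

text \<open>The condition \<open>Y \<subseteq> pos_quadrant\<close> makes the translate unique (for finite nonempty \<open>X\<close>):
  \<open>Y\<close> touches the first row and the first column.\<close>

definition normalize_shape :: "cell set \<Rightarrow> cell set" where
  "normalize_shape X = (THE Y. (\<exists>t. Y = translate t X) \<and> Y \<subseteq> pos_quadrant \<and>
     (\<forall>p q :: nat. p > 0 \<or> q > 0 \<longrightarrow> \<not> translate (- int p, - int q) Y \<subseteq> pos_quadrant))"

text \<open>The column inequality is weak, so that \<open>\<Delta>\<^sup>S v\<close> contains \<open>v\<close> and the cells of \<open>S\<close> above it.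
  With a strict inequality the index shape would not reach the left-most column of the coefficient
  shape, so that no top index tableau would exist unless the index shape is empty.\<close>

definition Delta :: "cell set \<Rightarrow> cell \<Rightarrow> cell set" where
  "Delta S v = {p \<in> S. fst p \<le> fst v \<and> snd p \<ge> snd v}"

definition penultimate_copy :: "cell set \<Rightarrow> nat \<Rightarrow> nat \<Rightarrow> cell set" where
  "penultimate_copy P w m = translate (scale (m - 1) (nabla P w)) P"

definition v_cell :: "cell set \<Rightarrow> nat \<Rightarrow> nat \<Rightarrow> cell" where
  "v_cell P w m = topleft_cell (penultimate_copy P w m)"

text \<open>This cell lies in the bottom row of \<open>penultimate_copy P w m\<close>.  The copy of \<open>P\<close> with index \<open>m\<close>
  lies entirely below that row, hence contributes nothing to the sets \<open>Delta\<close> used below.\<close>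

definition u_cell :: "cell set \<Rightarrow> nat \<Rightarrow> nat \<Rightarrow> cell" where
  "u_cell P w m = v_cell P w m - (1, 0) + nabla P w"

definition index_shape_at :: "cell set \<Rightarrow> nat \<Rightarrow> nat \<Rightarrow> cell set" where
  "index_shape_at P w m = normalize_shape (Delta (Sh P w m) (u_cell P w m))"

definition coeff_shape_at :: "cell set \<Rightarrow> nat \<Rightarrow> nat \<Rightarrow> cell set" where
  "coeff_shape_at P w m = normalize_shape
     (Delta (Sh P w m) (u_cell P w m) \<union> Delta (Sh P w m) (u_cell P w m - nabla P w) \<union>
      penultimate_copy P w m)"

definition eventual_value :: "(nat \<Rightarrow> 'a) \<Rightarrow> 'a" where
  "eventual_value f = (THE x. \<forall>\<^sub>F m in sequentially. f m = x)"

definition index_shape :: "cell set \<Rightarrow> nat \<Rightarrow> cell set" where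
  "index_shape P w = eventual_value (index_shape_at P w)"

definition coeff_shape :: "cell set \<Rightarrow> nat \<Rightarrow> cell set" where
  "coeff_shape P w = eventual_value (coeff_shape_at P w)"

definition index_dim :: "cell set \<Rightarrow> nat \<Rightarrow> nat" where
  "index_dim P w = card (SYT (index_shape P w))"

definition index_N :: "cell set \<Rightarrow> nat \<Rightarrow> nat" where
  "index_N P w = (LEAST m. \<exists>t. translate t (index_shape P w) \<subseteq> Sh P w m)"


subsection \<open>Tableau graphs and index tableaux\<close>

type_synonym tableau_graph = "cell set \<times> cell set set"

definition Tb :: "tableau \<Rightarrow> tableau_graph" where
  "Tb \<tau> = (dom \<tau>, {{p, q} | p q. p \<in> dom \<tau> \<and> q \<in> dom \<tau> \<and>
     fst p > fst q \<and> snd p < snd q \<and> the (\<tau> p) < the (\<tau> q)})"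

definition tg_iso :: "tableau_graph \<Rightarrow> tableau_graph \<Rightarrow> bool" where
  "tg_iso G H \<longleftrightarrow> (\<exists>t. translate t (fst G) = fst H \<and>
     (\<forall>a\<in>fst G. \<forall>b\<in>fst G. {a, b} \<in> snd G \<longleftrightarrow> {t + a, t + b} \<in> snd H))"

definition index_subtableau :: "cell set \<Rightarrow> nat \<Rightarrow> tableau \<Rightarrow> tableau \<Rightarrow> bool" where
  "index_subtableau P w \<tau> \<sigma> \<longleftrightarrow> (\<exists>X \<subseteq> dom \<tau>. \<sigma> = \<tau> |` X) \<and>
     (\<exists>\<xi> \<in> SYT (index_shape P w). tg_iso (Tb \<sigma>) (Tb \<xi>))"

definition top_index_tableau :: "cell set \<Rightarrow> nat \<Rightarrow> tableau \<Rightarrow> tableau" where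
  "top_index_tableau P w \<tau> = (THE \<sigma>. index_subtableau P w \<tau> \<sigma> \<and>
     top_row (dom \<sigma>) \<subseteq> top_row (dom \<tau>) \<and>
     leftmost_column (dom \<sigma>) \<subseteq> leftmost_column (dom \<tau>))"

text \<open>Serves both as the bottom index tableau of a tableau of the coefficient shape and as the
  index tableau of a tableau of shape \<open>Sh P w m\<close>: the two are given by the same condition.\<close>

definition bottom_index_tableau :: "cell set \<Rightarrow> nat \<Rightarrow> tableau \<Rightarrow> tableau" where
  "bottom_index_tableau P w \<tau> = (THE \<sigma>. index_subtableau P w \<tau> \<sigma> \<and>
     bottom_row (dom \<sigma>) \<subseteq> bottom_row (dom \<tau>) \<and>
     rightmost_column (dom \<sigma>) \<subseteq> rightmost_column (dom \<tau>))"


subsection \<open>Transfer matrix\<close>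

text \<open>The list \<open>ts\<close> is an enumeration of \<open>SYT (index_shape P w)\<close>; it fixes the common order of
  rows, columns and vector entries.\<close>

definition transfer_matrix :: "cell set \<Rightarrow> nat \<Rightarrow> tableau list \<Rightarrow> real mat" where
  "transfer_matrix P w ts = mat (index_dim P w) (index_dim P w) (\<lambda>(r, c).
     real (card {\<tau> \<in> SYT (coeff_shape P w).
       tg_iso (Tb (top_index_tableau P w \<tau>)) (Tb (ts ! c)) \<and>
       tg_iso (Tb (bottom_index_tableau P w \<tau>)) (Tb (ts ! r))}))"

definition ones_vector :: "cell set \<Rightarrow> nat \<Rightarrow> real vec" where
  "ones_vector P w = vec (index_dim P w) (\<lambda>_. 1)"

definition initial_vector :: "cell set \<Rightarrow> nat \<Rightarrow> tableau list \<Rightarrow> real vec" where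
  "initial_vector P w ts = vec (index_dim P w) (\<lambda>r.
     real (card {\<xi> \<in> SYT (Sh P w (index_N P w)).
       tg_iso (Tb (bottom_index_tableau P w \<xi>)) (Tb (ts ! r))}))"

end

theory Submission
  imports Defs
begin

text \<open>The shape \<open>Sh P w (n + 1)\<close> is \<open>A \<union> D \<union> B\<close>, where \<open>D\<close> is the copy of the index shape at the
  lower right end of \<open>A \<union> D = Sh P w n\<close>, and \<open>B\<close> is the new copy of \<open>P\<close>; the coefficient shape is
  \<open>D \<union> B\<close>.  The bottom left cell \<open>u\<close> of \<open>D\<close> lies directly above the top left cell of \<open>B\<close>, so
  every cell of \<open>A\<close> precedes \<open>u\<close> and \<open>u\<close> precedes every cell of \<open>B\<close>.  Hence a linear
  extension of the whole shape amounts to linear extensions of \<open>A \<union> D\<close> and of \<open>D \<union> B\<close> that agree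
  on \<open>D\<close>.  A tableau graph determines the order of a tableau of the index shape, since all pairs
  of cells which it does not record are comparable in every tableau.  So the numbers of tableaux with
  a given index tableau satisfy the linear recursion given by the transfer matrix, as soon as
  \<open>Sh P w n\<close> has enough rows to contain the index shape.\<close>

section \<open>Translations and normalization\<close>

text \<open>Tableaux are replaced by the strict linear orders that they induce on cells. Restricting
  a tableau leaves gaps in its values and gluing two tableaux requires renumbering, whereas orders
  are restricted by intersection and glued by union. The obstacle is at small indices: the part of
  \<open>Sh P w n\<close> that plays the index shape may lack cells near the top, because the blocks
  that would supply them are missing. The recursion needs the full index shape, while
  \<open>index_N\<close> only says that some translate of it fits somewhere; counting rows closes
  this gap. Compatibility enters twice. Connectedness of every \<open>Sh P w n\<close> makes cells
  in north-west to south-east position comparable and puts the cell u into the shape. The bound on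
  column sizes forces \<open>nabla P w\<close> to move strictly to the right, so that the index
  shapes stabilize.\<close>

lemma mem_translate [simp]: "x \<in> translate t S \<longleftrightarrow> x - t \<in> S"
proof
  assume "x - t \<in> S"
  then show "x \<in> translate t S"
    unfolding translate_def by (intro image_eqI [of _ _ "x - t"]) simp_all
qed (auto simp: translate_def)

lemma translate_translate: "translate s (translate t S) = translate (s + t) S"
  by (auto simp: diff_diff_eq)

lemma translate_0 [simp]: "translate 0 S = S"
  by auto

lemma translate_mono: "S \<subseteq> T \<Longrightarrow> translate t S \<subseteq> translate t T"
  by auto

lemma finite_translate [simp]: "finite (translate t S) \<longleftrightarrow> finite S"
  by (simp add: translate_def finite_image_iff)

lemma translate_eq_empty [simp]: "translate t S = {} \<longleftrightarrow> S = {}"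
  by (simp add: translate_def)

lemma fst_image_translate: "fst ` translate t S = (\<lambda>i. fst i + fst t) ` S"
  by (auto simp: translate_def image_image add.commute)

lemma snd_image_translate: "snd ` translate t S = (\<lambda>i. snd i + snd t) ` S"
  by (auto simp: translate_def image_image add.commute)

lemma Max_Min_translate:
  assumes "finite S" "S \<noteq> {}"
  shows "Max (fst ` translate t S) = Max (fst ` S) + fst t"
    and "Max (snd ` translate t S) = Max (snd ` S) + snd t"
    and "Min (fst ` translate t S) = Min (fst ` S) + fst t"
    and "Min (snd ` translate t S) = Min (snd ` S) + snd t"
  unfolding fst_image_translate snd_image_translate
  using assms by (simp_all add: Max_add_commute Min_add_commute)

text \<open>The extreme coordinates of a finite nonempty set reveal the shift. This makes the
  translation in a graph isomorphism unique.\<close>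

lemma translate_eq_cancel:
  assumes "finite S" "S \<noteq> {}" "translate s S = translate t S"
  shows "s = t"
  using Max_Min_translate(1,2)[OF assms(1,2), of s] Max_Min_translate(1,2)[OF assms(1,2), of t] assms(3)
  by (simp add: prod_eq_iff)

lemma topleft_cell_translate:
  assumes "finite S" "S \<noteq> {}"
  shows "topleft_cell (translate t S) = t + topleft_cell S"
proof -
  have "Min (fst ` S) \<in> fst ` S"
    using assms by simp
  then have "top_row S \<noteq> {}"
    unfolding top_row_def by force
  moreover have "top_row (translate t S) = translate t (top_row S)"
    using Max_Min_translate(3)[OF assms, of t] by (auto simp: top_row_def)
  moreover have "finite (top_row S)"
    using assms by (simp add: top_row_def)
  ultimately show ?thesis
    using Max_Min_translate(3)[OF assms, of t] Max_Min_translate(4)[of "top_row S" t]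
    by (simp add: topleft_cell_def prod_eq_iff)
qed

lemma mem_pos_quadrant: "x \<in> pos_quadrant \<longleftrightarrow> 1 \<le> fst x \<and> 1 \<le> snd x"
  by (cases x) (simp add: pos_quadrant_def)

lemma translate_subset_pos_quadrant:
  "translate t Y \<subseteq> pos_quadrant \<longleftrightarrow> (\<forall>x\<in>Y. 1 \<le> fst t + fst x \<and> 1 \<le> snd t + snd x)"
  by (simp add: translate_def mem_pos_quadrant image_subset_iff)

text \<open>If every row number were at least 2, the shape could move up by one and stay in the
  quadrant; likewise for columns. So both minima equal 1, which fixes the shift.\<close>

lemma normalize_shape_unique:
  assumes "finite X" "X \<noteq> {}"
    and "translate s X \<subseteq> pos_quadrant"
    and "\<forall>p q :: nat. p > 0 \<or> q > 0 \<longrightarrow> \<not> translate (- int p, - int q) (translate s X) \<subseteq> pos_quadrant"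
  shows "s = (1 - Min (fst ` X), 1 - Min (snd ` X))"
proof -
  let ?Y = "translate s X"
  have fin: "finite ?Y" "?Y \<noteq> {}"
    using assms by auto
  have ge: "1 \<le> fst x" "1 \<le> snd x" if "x \<in> ?Y" for x
    using subsetD[OF assms(3) that] by (simp_all add: mem_pos_quadrant del: mem_translate)
  with fin have min_ge: "1 \<le> Min (fst ` ?Y)" "1 \<le> Min (snd ` ?Y)"
    by (simp_all del: mem_translate)
  have "\<exists>x\<in>?Y. fst x \<le> 1"
  proof (rule ccontr)
    assume "\<not> ?thesis"
    then have "1 < fst x" if "x \<in> ?Y" for x
      using that by (meson not_le)
    with ge have "translate (- int 1, - int 0) ?Y \<subseteq> pos_quadrant"
      by (subst translate_subset_pos_quadrant) (simp del: mem_translate)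
    then show False
      using assms(4)[rule_format, of 1 0] by simp
  qed
  moreover have "\<exists>x\<in>?Y. snd x \<le> 1"
  proof (rule ccontr)
    assume "\<not> ?thesis"
    then have "1 < snd x" if "x \<in> ?Y" for x
      using that by (meson not_le)
    with ge have "translate (- int 0, - int 1) ?Y \<subseteq> pos_quadrant"
      by (subst translate_subset_pos_quadrant) (simp del: mem_translate)
    then show False
      using assms(4)[rule_format, of 0 1] by simp
  qed
  ultimately have "Min (fst ` ?Y) \<le> 1" "Min (snd ` ?Y) \<le> 1"
    by (meson Min_le finite_imageI fin(1) imageI order_trans)+
  with min_ge have "Min (fst ` ?Y) = 1" "Min (snd ` ?Y) = 1"
    by linarith+
  then show ?thesis
    using Max_Min_translate(3,4)[OF assms(1,2), of s] by (simp add: prod_eq_iff)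
qed

lemma normalize_shape_eq:
  assumes "finite X" "X \<noteq> {}"
  shows "normalize_shape X = translate (1 - Min (fst ` X), 1 - Min (snd ` X)) X"
proof -
  let ?s = "(1 - Min (fst ` X), 1 - Min (snd ` X))"
  let ?Y = "translate ?s X"
  have mn: "Min (fst ` ?Y) = 1" "Min (snd ` ?Y) = 1"
    using Max_Min_translate(3,4)[OF assms, of ?s] by simp_all
  have fin: "finite ?Y" "?Y \<noteq> {}"
    using assms by auto
  have sub: "?Y \<subseteq> pos_quadrant"
  proof
    fix x assume "x \<in> ?Y"
    then have "Min (fst ` ?Y) \<le> fst x" "Min (snd ` ?Y) \<le> snd x"
      using fin by (auto intro!: Min_le)
    then show "x \<in> pos_quadrant"
      using mn by (simp add: mem_pos_quadrant)
  qed
  have not_sub: "\<not> translate (- int p, - int q) ?Y \<subseteq> pos_quadrant" if "p > 0 \<or> q > 0" for p q :: nat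
  proof
    assume *: "translate (- int p, - int q) ?Y \<subseteq> pos_quadrant"
    have "Min (fst ` translate (- int p, - int q) ?Y) = 1 - int p"
      "Min (snd ` translate (- int p, - int q) ?Y) = 1 - int q"
      using Max_Min_translate(3,4)[OF fin, of "(- int p, - int q)"] mn by simp_all
    moreover have "1 \<le> fst x" "1 \<le> snd x" if "x \<in> translate (- int p, - int q) ?Y" for x
      using subsetD[OF * that] by (simp_all add: mem_pos_quadrant del: mem_translate)
    with fin have "1 \<le> Min (fst ` translate (- int p, - int q) ?Y)"
      "1 \<le> Min (snd ` translate (- int p, - int q) ?Y)"
      by (simp_all del: mem_translate)
    ultimately show False
      using that by linarith
  qed
  show ?thesis
    unfolding normalize_shape_def
  proof (rule the_equality)
    show "(\<exists>t. ?Y = translate t X) \<and> ?Y \<subseteq> pos_quadrant \<and>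
     (\<forall>p q :: nat. p > 0 \<or> q > 0 \<longrightarrow> \<not> translate (- int p, - int q) ?Y \<subseteq> pos_quadrant)"
      using sub not_sub by blast
  next
    fix Y
    assume "(\<exists>t. Y = translate t X) \<and> Y \<subseteq> pos_quadrant \<and>
     (\<forall>p q :: nat. p > 0 \<or> q > 0 \<longrightarrow> \<not> translate (- int p, - int q) Y \<subseteq> pos_quadrant)"
    then show "Y = ?Y"
      using normalize_shape_unique[OF assms] by metis
  qed
qed

lemma normalize_shape_translate:
  assumes "finite X" "X \<noteq> {}"
  shows "normalize_shape (translate t X) = normalize_shape X"
proof -
  have "(1 - Min (fst ` translate t X), 1 - Min (snd ` translate t X)) + t
      = (1 - Min (fst ` X), 1 - Min (snd ` X))"
    using Max_Min_translate(3,4)[OF assms, of t] by (simp add: prod_eq_iff)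
  then show ?thesis
    using assms by (simp add: normalize_shape_eq translate_translate)
qed

lemma eventual_value_eqI:
  assumes "\<And>m. m \<ge> k \<Longrightarrow> f m = x"
  shows "eventual_value f = x"
  unfolding eventual_value_def
proof (rule the_equality)
  show ev: "\<forall>\<^sub>F m in sequentially. f m = x"
    using assms by (auto simp: eventually_sequentially)
  show "y = x" if "\<forall>\<^sub>F m in sequentially. f m = y" for y
    using eventually_happens[OF eventually_conj[OF ev that]] by auto
qed

section \<open>Linear extensions\<close>

text \<open>Constraints are imposed only on neighbouring cells, exactly as for a tableau; that
  distant cells are then ordered too depends on connectedness, see
  \<open>linked_less\<close>.\<close>

definition linear_extensions :: "cell set \<Rightarrow> (cell \<times> cell) set set" where
  "linear_extensions S = {r. r \<subseteq> S \<times> S \<and> trans r \<and> irrefl r \<and> total_on S r \<and>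
     (\<forall>p\<in>S. \<forall>d\<in>{(0, 1), (1, 0)}. p + d \<in> S \<longrightarrow> (p, p + d) \<in> r)}"

definition tableau_order :: "tableau \<Rightarrow> (cell \<times> cell) set" where
  "tableau_order \<tau> = {(p, q). p \<in> dom \<tau> \<and> q \<in> dom \<tau> \<and> the (\<tau> p) < the (\<tau> q)}"

lemma tableau_order_in_linear_extensions:
  assumes "partial_tableau S \<tau>"
  shows "tableau_order \<tau> \<in> linear_extensions S"
proof -
  have d: "dom \<tau> = S" and inj: "inj_on \<tau> S"
    using assms by (auto simp: partial_tableau_def)
  have "total_on S (tableau_order \<tau>)"
  proof (rule total_onI)
    fix p q assume "p \<in> S" "q \<in> S" "p \<noteq> q"
    then have "the (\<tau> p) \<noteq> the (\<tau> q)"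
      using inj d by (metis domIff inj_on_eq_iff option.expand)
    then show "(p, q) \<in> tableau_order \<tau> \<or> (q, p) \<in> tableau_order \<tau>"
      using d \<open>p \<in> S\<close> \<open>q \<in> S\<close> by (auto simp: tableau_order_def)
  qed
  moreover have "(p, p + d) \<in> tableau_order \<tau>" if "p \<in> S" "d \<in> {(0, 1), (1, 0)}" "p + d \<in> S" for p d
  proof -
    obtain i j where "p = (i, j)"
      by (cases p)
    then have "the (\<tau> p) < the (\<tau> (p + d))"
      using assms that unfolding partial_tableau_def by (elim insertE) (simp_all del: domIff)
    then show ?thesis
      using that d by (simp add: tableau_order_def)
  qed
  ultimately show ?thesis
    unfolding linear_extensions_def
    using d by (auto simp: tableau_order_def trans_def irrefl_def)
qed

text \<open>The values are injective into \<open>{1..card S}\<close>, so they fill this interval and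
  an entry exceeds the number of smaller entries by one. Hence the order determines the
  tableau.\<close>

lemma SYT_value:
  assumes "finite S" "\<tau> \<in> SYT S" "p \<in> S"
  shows "\<tau> p = Some (Suc (card {q. (q, p) \<in> tableau_order \<tau>}))"
proof -
  define f where "f = (\<lambda>q. the (\<tau> q))"
  have pt: "partial_tableau S \<tau>" and rn: "ran \<tau> \<subseteq> {1..card S}"
    using assms by (auto simp: SYT_def)
  have d: "dom \<tau> = S" and inj: "inj_on \<tau> S"
    using pt by (auto simp: partial_tableau_def)
  have injf: "inj_on f S"
  proof (rule inj_onI)
    fix x y assume "x \<in> S" "y \<in> S" "f x = f y"
    then have "\<tau> x = \<tau> y"
      using d unfolding f_def by (intro option.expand) auto
    then show "x = y"
      using inj \<open>x \<in> S\<close> \<open>y \<in> S\<close> by (simp add: inj_on_eq_iff)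
  qed
  have "f ` S \<subseteq> {1..card S}"
    using rn d unfolding f_def ran_def by force
  then have img: "f ` S = {1..card S}"
    using injf by (simp add: card_image card_subset_eq)
  have "f ` {q. (q, p) \<in> tableau_order \<tau>} = {1..<f p}"
  proof
    show "f ` {q. (q, p) \<in> tableau_order \<tau>} \<subseteq> {1..<f p}"
      using img d by (force simp: tableau_order_def f_def)
    show "{1..<f p} \<subseteq> f ` {q. (q, p) \<in> tableau_order \<tau>}"
    proof
      fix k assume k: "k \<in> {1..<f p}"
      have "f p \<in> {1..card S}"
        using img assms(3) by blast
      with k have "k \<in> f ` S"
        unfolding img by auto
      then obtain q where "q \<in> S" "f q = k"
        by blast
      then show "k \<in> f ` {q. (q, p) \<in> tableau_order \<tau>}"
        using k d assms(3) by (auto simp: tableau_order_def f_def)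
    qed
  qed
  moreover have "inj_on f {q. (q, p) \<in> tableau_order \<tau>}"
    using injf d by (auto simp: tableau_order_def inj_on_def)
  ultimately have "card {q. (q, p) \<in> tableau_order \<tau>} = f p - 1"
    using card_image by fastforce
  moreover have "f p \<ge> 1"
    using img assms(3) by fastforce
  ultimately show ?thesis
    using d assms(3) by (auto simp: f_def)
qed

lemma tableau_order_bij:
  assumes "finite S"
  shows "bij_betw tableau_order (SYT S) (linear_extensions S)"
proof (rule bij_betw_imageI)
  show "inj_on tableau_order (SYT S)"
  proof (rule inj_onI, rule ext)
    fix \<tau> \<tau>' p
    assume *: "\<tau> \<in> SYT S" "\<tau>' \<in> SYT S" "tableau_order \<tau> = tableau_order \<tau>'"
    show "\<tau> p = \<tau>' p"
    proof (cases "p \<in> S")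
      case True
      then show ?thesis
        using SYT_value[OF assms *(1) True] SYT_value[OF assms *(2) True] *(3) by simp
    next
      case False
      then show ?thesis
        using *(1,2) by (auto simp: SYT_def partial_tableau_def dom_def)
    qed
  qed
  show "tableau_order ` SYT S = linear_extensions S"
  proof (intro equalityI subsetI)
    fix r assume "r \<in> tableau_order ` SYT S"
    then show "r \<in> linear_extensions S"
      by (auto simp: SYT_def intro: tableau_order_in_linear_extensions)
  next
    fix r assume "r \<in> linear_extensions S"
    then have r: "r \<subseteq> S \<times> S" "trans r" "irrefl r" "total_on S r"
      and step: "\<And>p d. p \<in> S \<Longrightarrow> d \<in> {(0, 1), (1, 0)} \<Longrightarrow> p + d \<in> S \<Longrightarrow> (p, p + d) \<in> r"
      by (auto simp: linear_extensions_def)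
    \<comment> \<open>The preimage of an order is its rank function, counted from 1.\<close>
    define f where "f = (\<lambda>p. Suc (card {q. (q, p) \<in> r}))"
    define \<tau> where "\<tau> = (\<lambda>p. if p \<in> S then Some (f p) else None)"
    have fin: "finite {q. (q, p) \<in> r}" for p
      by (rule finite_subset[OF _ assms]) (use r(1) in auto)
    \<comment> \<open>Transitivity gives the inclusion of the sets of predecessors; it is proper
      because \<open>p\<close> precedes \<open>q\<close> but not itself.\<close>
    have mono: "f p < f q" if "(p, q) \<in> r" for p q
    proof -
      have "{x. (x, p) \<in> r} \<subset> {x. (x, q) \<in> r}"
        using that r(2,3) unfolding irrefl_def by (blast dest: transD)
      then show ?thesis
        unfolding f_def using psubset_card_mono[OF fin] by simp
    qed
    have iff: "(p, q) \<in> r \<longleftrightarrow> p \<in> S \<and> q \<in> S \<and> f p < f q" for p q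
      using mono[of p q] mono[of q p] r(1,4) unfolding total_on_def
      by (metis mem_Sigma_iff order.asym order.irrefl subsetD)
    have dom: "dom \<tau> = S"
      by (auto simp: \<tau>_def dom_def)
    have "tableau_order \<tau> = r"
      unfolding tableau_order_def dom by (auto simp: iff \<tau>_def)
    moreover have "\<tau> \<in> SYT S"
      unfolding SYT_def partial_tableau_def
    proof (intro CollectI conjI allI impI)
      show "dom \<tau> = S"
        by (rule dom)
      show "inj_on \<tau> S"
        using mono r(4) by (fastforce simp: inj_on_def \<tau>_def total_on_def)
      show "the (\<tau> (i, j)) < the (\<tau> (i, j + 1))" if "(i, j) \<in> S" "(i, j + 1) \<in> S" for i j
        using mono step[of "(i, j)" "(0, 1)"] that by (simp add: \<tau>_def)
      show "the (\<tau> (i, j)) < the (\<tau> (i + 1, j))" if "(i, j) \<in> S" "(i + 1, j) \<in> S" for i j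
        using mono step[of "(i, j)" "(1, 0)"] that by (simp add: \<tau>_def)
      have "f p \<le> card S" if "p \<in> S" for p
      proof -
        have "{q. (q, p) \<in> r} \<subset> S"
          using r(1) that irreflD[OF r(3)] by blast
        then show ?thesis
          unfolding f_def using psubset_card_mono[OF assms] by (simp add: Suc_le_eq)
      qed
      moreover have "1 \<le> f p" for p
        by (simp add: f_def)
      ultimately show "ran \<tau> \<subseteq> {1..card S}"
        by (auto simp: ran_def \<tau>_def split: if_splits)
    qed
    ultimately show "r \<in> tableau_order ` SYT S"
      by blast
  qed
qed

section \<open>Translation and restriction of linear extensions\<close>

definition shift_rel :: "cell \<Rightarrow> (cell \<times> cell) set \<Rightarrow> (cell \<times> cell) set" where
  "shift_rel t r = {(p, q). (p - t, q - t) \<in> r}"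

lemma mem_shift_rel [simp]: "(p, q) \<in> shift_rel t r \<longleftrightarrow> (p - t, q - t) \<in> r"
  by (simp add: shift_rel_def)

lemma shift_rel_shift_rel: "shift_rel s (shift_rel t r) = shift_rel (s + t) r"
  unfolding shift_rel_def by (simp add: diff_diff_eq)

lemma shift_rel_0 [simp]: "shift_rel 0 r = r"
  by (simp add: shift_rel_def)

lemma shift_rel_eq_iff [simp]: "shift_rel t r = shift_rel t s \<longleftrightarrow> r = s"
  by (metis add.left_inverse shift_rel_0 shift_rel_shift_rel)

lemma shift_rel_Int_Times:
  "shift_rel t (r \<inter> X \<times> X) = shift_rel t r \<inter> translate t X \<times> translate t X"
  by (auto simp: shift_rel_def)

lemma shift_rel_in_linear_extensions:
  assumes "r \<in> linear_extensions S"
  shows "shift_rel t r \<in> linear_extensions (translate t S)"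
proof -
  have r: "r \<subseteq> S \<times> S" "trans r" "irrefl r" "total_on S r"
    and step: "\<And>p d. p \<in> S \<Longrightarrow> d \<in> {(0, 1), (1, 0)} \<Longrightarrow> p + d \<in> S \<Longrightarrow> (p, p + d) \<in> r"
    using assms by (auto simp: linear_extensions_def)
  have "trans (shift_rel t r)"
    by (rule transI) (use transD[OF r(2)] in auto)
  moreover have "irrefl (shift_rel t r)"
    using irreflD[OF r(3)] by (auto simp only: irrefl_def mem_shift_rel)
  moreover have "total_on (translate t S) (shift_rel t r)"
  proof (rule total_onI)
    fix p q assume "p \<in> translate t S" "q \<in> translate t S" "p \<noteq> q"
    then show "(p, q) \<in> shift_rel t r \<or> (q, p) \<in> shift_rel t r"
      using r(4)[unfolded total_on_def, rule_format, of "p - t" "q - t"] by simp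
  qed
  moreover have "(p, p + d) \<in> shift_rel t r"
    if "p \<in> translate t S" "d \<in> {(0, 1), (1, 0)}" "p + d \<in> translate t S" for p d
  proof -
    have "p + d - t = p - t + d"
      by simp
    with step[of "p - t" d] that show ?thesis
      unfolding mem_shift_rel mem_translate by metis
  qed
  moreover have "shift_rel t r \<subseteq> translate t S \<times> translate t S"
    using r(1) by (auto simp: shift_rel_def)
  ultimately show ?thesis
    unfolding linear_extensions_def by blast
qed

lemma shift_rel_bij:
  "bij_betw (shift_rel t) (linear_extensions S) (linear_extensions (translate t S))"
proof (rule bij_betw_byWitness[where f' = "shift_rel (- t)"])
  show "shift_rel (- t) ` linear_extensions (translate t S) \<subseteq> linear_extensions S"
    using shift_rel_in_linear_extensions[of _ "translate t S" "- t"]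
    by (auto simp: translate_translate)
qed (auto simp: shift_rel_shift_rel intro: shift_rel_in_linear_extensions)

lemma finite_linear_extensions:
  assumes "finite S"
  shows "finite (linear_extensions S)"
  by (rule finite_subset[of _ "Pow (S \<times> S)"]) (auto simp: linear_extensions_def assms)

text \<open>A unit step between cells of \<open>X\<close> is also one between cells of
  \<open>S\<close>, so \<open>r\<close> already contains every pair required on
  \<open>X\<close>.\<close>

lemma linear_extensions_restrict:
  assumes "r \<in> linear_extensions S" "X \<subseteq> S"
  shows "r \<inter> X \<times> X \<in> linear_extensions X"
proof -
  have r: "r \<subseteq> S \<times> S" "trans r" "irrefl r" "total_on S r"
    and step: "\<And>p d. p \<in> S \<Longrightarrow> d \<in> {(0, 1), (1, 0)} \<Longrightarrow> p + d \<in> S \<Longrightarrow> (p, p + d) \<in> r"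
    using assms by (auto simp: linear_extensions_def)
  have "trans (r \<inter> X \<times> X)"
    using transD[OF r(2)] unfolding trans_def by blast
  moreover have "irrefl (r \<inter> X \<times> X)"
    using irreflD[OF r(3)] unfolding irrefl_def by blast
  moreover have "total_on X (r \<inter> X \<times> X)"
    using r(4) assms(2) unfolding total_on_def by blast
  ultimately show ?thesis
    unfolding linear_extensions_def using step assms(2) by blast
qed

section \<open>Linked shapes and tableau graphs\<close>

text \<open>On a linked shape every linear extension compares all pairs of cells in weakly
  north-west to south-east position, so it is determined by the pairs that the tableau graph
  records.\<close>

definition linked :: "cell set \<Rightarrow> bool" where
  "linked S \<longleftrightarrow> (\<forall>p\<in>S. \<forall>q\<in>S. fst p \<le> fst q \<longrightarrow> snd p \<le> snd q \<longrightarrow> p \<noteq> q \<longrightarrow>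
     fst p < fst q \<and> p + (1, 0) \<in> S \<or> snd p < snd q \<and> p + (0, 1) \<in> S)"

text \<open>One step of a lattice path from \<open>p\<close> to \<open>q\<close>, with decreasing
  taxicab distance; it drives the two inductions that follow.\<close>

lemma linked_step:
  assumes "linked S" "p \<in> S" "q \<in> S" "fst p \<le> fst q" "snd p \<le> snd q" "p \<noteq> q"
  obtains d where "d \<in> {(0, 1), (1, 0)}" "p + d \<in> S" "fst (p + d) \<le> fst q" "snd (p + d) \<le> snd q"
    "nat (fst q - fst (p + d) + (snd q - snd (p + d))) < nat (fst q - fst p + (snd q - snd p))"
proof -
  from assms consider "fst p < fst q" "p + (1, 0) \<in> S" | "snd p < snd q" "p + (0, 1) \<in> S"
    unfolding linked_def by blast
  then show ?thesis
  proof cases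
    case 1
    then show ?thesis
      using assms by (intro that[of "(1, 0)"]) auto
  next
    case 2
    then show ?thesis
      using assms by (intro that[of "(0, 1)"]) auto
  qed
qed

text \<open>Unit steps to the right or down lead from \<open>p\<close> to \<open>q\<close> inside
  \<open>S\<close>; \<open>r\<close> respects each of them, and transitivity chains them.\<close>

lemma linked_less:
  assumes "linked S" "r \<in> linear_extensions S"
    and "p \<in> S" "q \<in> S" "fst p \<le> fst q" "snd p \<le> snd q" "p \<noteq> q"
  shows "(p, q) \<in> r"
  using assms(3-)
proof (induction "nat (fst q - fst p + (snd q - snd p))" arbitrary: p rule: less_induct)
  case less
  obtain d where d: "d \<in> {(0, 1), (1, 0)}" "p + d \<in> S" "fst (p + d) \<le> fst q" "snd (p + d) \<le> snd q"
    "nat (fst q - fst (p + d) + (snd q - snd (p + d))) < nat (fst q - fst p + (snd q - snd p))"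
    using linked_step[OF assms(1) less.prems] .
  have *: "(p, p + d) \<in> r" "trans r"
    using assms(2) d less.prems unfolding linear_extensions_def by blast+
  show ?case
  proof (cases "p + d = q")
    case False
    then have "(p + d, q) \<in> r"
      using less.hyps[OF d(5)] d less.prems by blast
    with * show ?thesis
      by (blast dest: transD)
  qed (use * in simp)
qed

text \<open>The last step of such a path arrives from above or from the left. This will locate the
  cell above the top left cell of a block.\<close>

lemma linked_predecessor:
  assumes "linked S" "p \<in> S" "q \<in> S" "fst p \<le> fst q" "snd p \<le> snd q" "p \<noteq> q"
  shows "q - (1, 0) \<in> S \<or> q - (0, 1) \<in> S"
  using assms(2-)
proof (induction "nat (fst q - fst p + (snd q - snd p))" arbitrary: p rule: less_induct)
  case less
  obtain d where d: "d \<in> {(0, 1), (1, 0)}" "p + d \<in> S" "fst (p + d) \<le> fst q" "snd (p + d) \<le> snd q"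
    "nat (fst q - fst (p + d) + (snd q - snd (p + d))) < nat (fst q - fst p + (snd q - snd p))"
    using linked_step[OF assms(1) less.prems] .
  show ?case
  proof (cases "p + d = q")
    case True
    then have "q - d \<in> S"
      using less.prems by auto
    then show ?thesis
      using d(1) by auto
  next
    case False
    then show ?thesis
      using less.hyps[OF d(5)] d less.prems by blast
  qed
qed

lemma linked_translate:
  assumes "linked S"
  shows "linked (translate t S)"
  unfolding linked_def
proof (intro ballI impI)
  fix p q assume *: "p \<in> translate t S" "q \<in> translate t S" "fst p \<le> fst q" "snd p \<le> snd q" "p \<noteq> q"
  have eq: "p + d - t = p - t + d" for d
    by simp
  have "p - t \<noteq> q - t"
    using * by simp
  with * assms have "fst (p - t) < fst (q - t) \<and> p - t + (1, 0) \<in> S \<or> snd (p - t) < snd (q - t) \<and> p - t + (0, 1) \<in> S"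
    unfolding linked_def mem_translate by (smt (verit) fst_diff snd_diff)
  then show "fst p < fst q \<and> p + (1, 0) \<in> translate t S \<or> snd p < snd q \<and> p + (0, 1) \<in> translate t S"
    unfolding mem_translate eq by simp
qed

text \<open>Steps to the right or down never leave the columns from \<open>c\<close> on.\<close>

lemma linked_columns_ge:
  assumes "linked S"
  shows "linked {x \<in> S. c \<le> snd x}"
  using assms unfolding linked_def by fastforce

text \<open>This is all that is needed of the shape of a French skew diagram.\<close>

definition ne_convex :: "cell set \<Rightarrow> bool" where
  "ne_convex S \<longleftrightarrow> (\<forall>p\<in>S. \<forall>q\<in>S. \<forall>x y.
     fst q \<le> x \<longrightarrow> x \<le> fst p \<longrightarrow> snd p \<le> y \<longrightarrow> y \<le> snd q \<longrightarrow> (x, y) \<in> S)"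

lemma ne_convexD:
  "ne_convex S \<Longrightarrow> p \<in> S \<Longrightarrow> q \<in> S \<Longrightarrow> fst q \<le> fst x \<Longrightarrow> fst x \<le> fst p \<Longrightarrow>
    snd p \<le> snd x \<Longrightarrow> snd x \<le> snd q \<Longrightarrow> x \<in> S"
  unfolding ne_convex_def by (metis prod.collapse)

text \<open>In French notation higher rows start and end weakly further left. So a row between those
  of \<open>p\<close> and \<open>q\<close> starts no later than the row of \<open>p\<close> and ends
  no earlier than the row of \<open>q\<close>.\<close>

lemma ne_convex_french_skew:
  assumes "sorted_wrt (\<ge>) lam" "sorted_wrt (\<ge>) mu" "length lam \<le> length mu"
  shows "ne_convex (french_skew lam mu)"
  unfolding ne_convex_def
proof (intro ballI allI impI)
  fix p q x y
  assume "p \<in> french_skew lam mu" "q \<in> french_skew lam mu"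
  then obtain k l where k: "fst p = - int k" "k < length lam" "int (mu ! k) + 1 \<le> snd p"
    and l: "fst q = - int l" "l < length lam" "snd q \<le> int (lam ! l)"
    unfolding french_skew_def by auto
  assume *: "fst q \<le> x" "x \<le> fst p" "snd p \<le> y" "y \<le> snd q"
  define m where "m = nat (- x)"
  have m: "x = - int m" "k \<le> m" "m \<le> l"
    using k(1) l(1) * by (auto simp: m_def)
  have "mu ! m \<le> mu ! k"
    using sorted_wrt_nth_less[OF assms(2), of k m] m l(2) assms(3) by (cases "k = m") auto
  moreover have "lam ! l \<le> lam ! m"
    using sorted_wrt_nth_less[OF assms(1), of m l] m l(2) by (cases "m = l") auto
  ultimately show "(x, y) \<in> french_skew lam mu"
    unfolding french_skew_def using m k l * by auto
qed

lemma ne_convex_skew_diagram: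
  assumes "is_skew_diagram S"
  shows "ne_convex S"
proof -
  obtain lam mu t where *: "sorted_wrt (\<ge>) lam" "sorted_wrt (\<ge>) mu" "length lam \<le> length mu"
    and S: "S = translate t (french_skew lam mu)"
    using assms unfolding is_skew_diagram_def by blast
  show ?thesis
    unfolding ne_convex_def
  proof (intro ballI allI impI)
    fix p q x y
    assume "p \<in> S" "q \<in> S" "fst q \<le> x" "x \<le> fst p" "snd p \<le> y" "y \<le> snd q"
    then have "(x, y) - t \<in> french_skew lam mu"
      unfolding S mem_translate
      by (elim ne_convexD[OF ne_convex_french_skew[OF *], of "p - t" "q - t"]) auto
    then show "(x, y) \<in> S"
      by (simp add: S)
  qed
qed

lemma connected_cells_closed:
  assumes "connected_cells S" "p \<in> S" "q \<in> S" "p \<in> K"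
    and "\<And>x y. x \<in> S \<Longrightarrow> y \<in> S \<Longrightarrow> x \<in> K \<Longrightarrow> adjacent x y \<Longrightarrow> y \<in> K"
  shows "q \<in> K"
proof -
  have "(p, q) \<in> {(x, y). x \<in> S \<and> y \<in> S \<and> adjacent x y}\<^sup>*"
    using assms unfolding connected_cells_def by blast
  then show ?thesis
    by (induction rule: rtrancl_induct) (use assms(4,5) in blast)+
qed

text \<open>Within a row or column convexity suffices. Otherwise suppose that \<open>S\<close>
  contains neither the lower nor the right neighbour of \<open>p\<close>. A step out of the quadrant
  north-west of \<open>p\<close> would reach a cell that together with \<open>p\<close> forces one
  of these neighbours into \<open>S\<close>, so connectedness confines \<open>S\<close> to that
  quadrant, which excludes \<open>q\<close>.\<close>

lemma ne_convex_connected_linked: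
  assumes conv: "ne_convex S" and conn: "connected_cells S"
  shows "linked S"
  unfolding linked_def
proof (intro ballI impI)
  fix p q
  assume p: "p \<in> S" and q: "q \<in> S" and pq: "fst p \<le> fst q" "snd p \<le> snd q" "p \<noteq> q"
  consider "fst p = fst q" "snd p < snd q" | "snd p = snd q" "fst p < fst q"
    | "fst p < fst q" "snd p < snd q"
    using pq by (force simp: prod_eq_iff)
  then show "fst p < fst q \<and> p + (1, 0) \<in> S \<or> snd p < snd q \<and> p + (0, 1) \<in> S"
  proof cases
    case 1
    then show ?thesis
      using ne_convexD[OF conv p q, of "p + (0, 1)"] by simp
  next
    case 2
    then show ?thesis
      using ne_convexD[OF conv q p, of "p + (1, 0)"] by simp
  next
    case 3
    have "p + (1, 0) \<in> S \<or> p + (0, 1) \<in> S"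
    proof (rule ccontr)
      assume no: "\<not> ?thesis"
      let ?K = "{x. fst x \<le> fst p \<and> snd x \<le> snd p}"
      have "q \<in> ?K"
      proof (rule connected_cells_closed[OF conn p q])
        fix x y
        assume x: "x \<in> S" "x \<in> ?K" and y: "y \<in> S" and adj: "adjacent x y"
        have eq: "fst y = fst x + fst (y - x)" "snd y = snd x + snd (y - x)"
          by simp_all
        consider "y \<in> ?K" | "fst y = fst p + 1" "snd y \<le> snd p" | "snd y = snd p + 1" "fst y \<le> fst p"
        proof -
          have "fst y \<le> fst x \<and> snd y \<le> snd x \<or> fst y = fst x + 1 \<and> snd y = snd x \<or>
            fst y = fst x \<and> snd y = snd x + 1"
            using adj eq unfolding adjacent_def by (elim insertE) (simp_all del: fst_diff snd_diff)
          then show ?thesis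
            using x(2) that by fastforce
        qed
        then show "y \<in> ?K"
        proof cases
          case 2
          then have "p + (1, 0) \<in> S"
            using ne_convexD[OF conv y p, of "p + (1, 0)"] by simp
          then show ?thesis
            using no by simp
        next
          case 3
          then have "p + (0, 1) \<in> S"
            using ne_convexD[OF conv p y, of "p + (0, 1)"] by simp
          then show ?thesis
            using no by simp
        qed
      qed simp
      then show False
        using 3 by simp
    qed
    then show ?thesis
      using 3 by blast
  qed
qed

text \<open>An edge is unordered, but positions give its orientation: the south-western cell has the
  smaller entry.\<close>

lemma Tb_edge_iff:
  "{a, b} \<in> snd (Tb \<tau>) \<longleftrightarrow> a \<in> dom \<tau> \<and> b \<in> dom \<tau> \<and>
     (fst a > fst b \<and> snd a < snd b \<and> (a, b) \<in> tableau_order \<tau> \<or>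
      fst b > fst a \<and> snd b < snd a \<and> (b, a) \<in> tableau_order \<tau>)"
  unfolding Tb_def tableau_order_def snd_conv mem_Collect_eq doubleton_eq_iff case_prod_conv by blast

text \<open>The vertex sets leave only one possible translation. Edges and non-edges settle the
  pairs in south-west to north-east position, and \<open>linked_less\<close> settles all others, so
  graph and order carry the same information.\<close>

lemma tg_iso_iff:
  assumes fin: "finite X" "X \<noteq> {}" and lnk: "linked X"
    and pt: "partial_tableau X \<sigma>" "partial_tableau (translate t X) \<xi>"
  shows "tg_iso (Tb \<sigma>) (Tb \<xi>) \<longleftrightarrow> tableau_order \<xi> = shift_rel t (tableau_order \<sigma>)"
proof -
  have dom: "dom \<sigma> = X" "dom \<xi> = translate t X"
    using pt by (auto simp: partial_tableau_def)
  let ?r = "tableau_order \<sigma>" and ?s = "shift_rel (- t) (tableau_order \<xi>)"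
  have le: "?r \<in> linear_extensions X" "?s \<in> linear_extensions X"
    using tableau_order_in_linear_extensions[OF pt(1)]
      shift_rel_in_linear_extensions[OF tableau_order_in_linear_extensions[OF pt(2)], of "- t"]
    by (auto simp: translate_translate)
  have iso: "tg_iso (Tb \<sigma>) (Tb \<xi>) \<longleftrightarrow>
    (\<forall>a\<in>X. \<forall>b\<in>X. {a, b} \<in> snd (Tb \<sigma>) \<longleftrightarrow> {t + a, t + b} \<in> snd (Tb \<xi>))"
  proof -
    have "fst (Tb \<sigma>) = X" "fst (Tb \<xi>) = translate t X"
      using dom by (simp_all add: Tb_def)
    then show ?thesis
      unfolding tg_iso_def using translate_eq_cancel[OF fin] by metis
  qed
  have edge: "{t + a, t + b} \<in> snd (Tb \<xi>) \<longleftrightarrow> a \<in> X \<and> b \<in> X \<and>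
     (fst a > fst b \<and> snd a < snd b \<and> (a, b) \<in> ?s \<or>
      fst b > fst a \<and> snd b < snd a \<and> (b, a) \<in> ?s)" for a b
    unfolding Tb_edge_iff dom(2) by (simp add: add.commute)
  have edge': "{a, b} \<in> snd (Tb \<sigma>) \<longleftrightarrow> a \<in> X \<and> b \<in> X \<and>
     (fst a > fst b \<and> snd a < snd b \<and> (a, b) \<in> ?r \<or>
      fst b > fst a \<and> snd b < snd a \<and> (b, a) \<in> ?r)" for a b
    unfolding Tb_edge_iff dom(1) by simp
  have "?r = ?s" if "\<forall>a\<in>X. \<forall>b\<in>X. {a, b} \<in> snd (Tb \<sigma>) \<longleftrightarrow> {t + a, t + b} \<in> snd (Tb \<xi>)"
  proof -
    have main: "(a, b) \<in> s" if ab: "(a, b) \<in> r" and r: "r \<in> linear_extensions X" and s: "s \<in> linear_extensions X"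
      and rs: "\<And>a b. a \<in> X \<Longrightarrow> b \<in> X \<Longrightarrow> fst a > fst b \<Longrightarrow> snd a < snd b \<Longrightarrow> (a, b) \<in> r \<longleftrightarrow> (a, b) \<in> s" for a b r s
    proof -
      have X: "a \<in> X" "b \<in> X"
        using ab r unfolding linear_extensions_def by blast+
      have no: "(b, a) \<notin> r" "a \<noteq> b" "total_on X s"
        using ab r s unfolding linear_extensions_def by (blast dest: transD irreflD)+
      consider "fst a \<le> fst b" "snd a \<le> snd b" | "fst b \<le> fst a" "snd b \<le> snd a"
        | "fst a > fst b" "snd a < snd b" | "fst b > fst a" "snd b < snd a"
        by linarith
      then show ?thesis
      proof cases
        case 1
        then show ?thesis
          using linked_less[OF lnk s] X no by blast
      next
        case 2
        then show ?thesis
          using linked_less[OF lnk r, of b a] X no by blast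
      next
        case 3
        then show ?thesis
          using rs X ab by blast
      next
        \<comment> \<open>Here a missing edge counts: \<open>(b, a)\<close> is not in
          \<open>r\<close>, hence not in \<open>s\<close>, and totality gives
          \<open>(a, b)\<close>.\<close>
        case 4
        then show ?thesis
          using rs[OF X(2,1)] X no unfolding total_on_def by blast
      qed
    qed
    have "(a, b) \<in> ?r \<longleftrightarrow> (a, b) \<in> ?s" if "a \<in> X" "b \<in> X" "fst a > fst b" "snd a < snd b" for a b
      using \<open>\<forall>a\<in>X. \<forall>b\<in>X. _\<close>[rule_format, OF that(1,2)] that unfolding edge edge' by auto
    then show ?thesis
      using main[OF _ le] main[OF _ le(2,1)] by (metis subrelI subset_antisym)
  qed
  then have "tg_iso (Tb \<sigma>) (Tb \<xi>) \<longleftrightarrow> ?r = ?s"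
    unfolding iso by (auto simp only: edge edge')
  also have "\<dots> \<longleftrightarrow> tableau_order \<xi> = shift_rel t ?r"
    by (metis (no_types) add.right_inverse shift_rel_0 shift_rel_shift_rel shift_rel_eq_iff)
  finally show ?thesis .
qed

section \<open>Restrictions of tableaux and the position of index tableaux\<close>

lemma partial_tableau_restrict:
  assumes "partial_tableau S \<tau>" "X \<subseteq> S"
  shows "partial_tableau X (\<tau> |` X)"
proof -
  have "dom \<tau> = S" "inj_on \<tau> S"
    using assms(1) by (simp_all add: partial_tableau_def)
  then have "dom (\<tau> |` X) = X" "inj_on (\<tau> |` X) X"
    using assms(2) by (auto simp: inj_on_def) blast+
  then show ?thesis
    using assms unfolding partial_tableau_def by (simp add: subset_iff)
qed

lemma tableau_order_restrict: "tableau_order (\<tau> |` X) = tableau_order \<tau> \<inter> X \<times> X"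
  by (auto simp: tableau_order_def)

text \<open>This and the next three lemmas reduce the containments that define index tableaux to
  equal extreme coordinates; one such equality for rows and one for columns fix the position of a
  translate.\<close>

lemma bottom_row_subset_iff:
  assumes "finite S" "X \<subseteq> S" "X \<noteq> {}"
  shows "bottom_row X \<subseteq> bottom_row S \<longleftrightarrow> Max (fst ` X) = Max (fst ` S)"
proof -
  have "Max (fst ` X) \<in> fst ` X"
    using assms finite_subset by (intro Max_in) auto
  then have "\<exists>x\<in>X. fst x = Max (fst ` X)"
    by (metis imageE)
  then show ?thesis
    using assms(2) unfolding bottom_row_def by auto
qed

lemma top_row_subset_iff:
  assumes "finite S" "X \<subseteq> S" "X \<noteq> {}"
  shows "top_row X \<subseteq> top_row S \<longleftrightarrow> Min (fst ` X) = Min (fst ` S)"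
proof -
  have "Min (fst ` X) \<in> fst ` X"
    using assms finite_subset by (intro Min_in) auto
  then have "\<exists>x\<in>X. fst x = Min (fst ` X)"
    by (metis imageE)
  then show ?thesis
    using assms(2) unfolding top_row_def by auto
qed

lemma rightmost_column_subset_iff:
  assumes "finite S" "X \<subseteq> S" "X \<noteq> {}"
  shows "rightmost_column X \<subseteq> rightmost_column S \<longleftrightarrow> Max (snd ` X) = Max (snd ` S)"
proof -
  have "Max (snd ` X) \<in> snd ` X"
    using assms finite_subset by (intro Max_in) auto
  then have "\<exists>x\<in>X. snd x = Max (snd ` X)"
    by (metis imageE)
  then show ?thesis
    using assms(2) unfolding rightmost_column_def by auto
qed

lemma leftmost_column_subset_iff:
  assumes "finite S" "X \<subseteq> S" "X \<noteq> {}"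
  shows "leftmost_column X \<subseteq> leftmost_column S \<longleftrightarrow> Min (snd ` X) = Min (snd ` S)"
proof -
  have "Min (snd ` X) \<in> snd ` X"
    using assms finite_subset by (intro Min_in) auto
  then have "\<exists>x\<in>X. snd x = Min (snd ` X)"
    by (metis imageE)
  then show ?thesis
    using assms(2) unfolding leftmost_column_def by auto
qed

lemma Max_image_eq_subset:
  fixes f :: "'a \<Rightarrow> 'b :: linorder"
  assumes "finite S" "X \<subseteq> S" "X \<noteq> {}" "\<And>x. x \<in> S \<Longrightarrow> \<exists>y\<in>X. f x \<le> f y"
  shows "Max (f ` X) = Max (f ` S)"
proof (rule antisym)
  show "Max (f ` X) \<le> Max (f ` S)"
    using assms by (intro Max_mono) auto
  have "finite X"
    using assms finite_subset by blast
  then have "f x \<le> Max (f ` X)" if "x \<in> S" for x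
    using assms(4)[OF that] by (meson Max_ge finite_imageI imageI order_trans)
  then show "Max (f ` S) \<le> Max (f ` X)"
    using assms by (intro Max.boundedI) auto
qed

lemma Min_image_eq_subset:
  fixes f :: "'a \<Rightarrow> 'b :: linorder"
  assumes "finite S" "X \<subseteq> S" "X \<noteq> {}" "\<And>x. x \<in> S \<Longrightarrow> \<exists>y\<in>X. f y \<le> f x"
  shows "Min (f ` X) = Min (f ` S)"
proof (rule antisym)
  show "Min (f ` S) \<le> Min (f ` X)"
    using assms by (intro Min_antimono) auto
  have "finite X"
    using assms finite_subset by blast
  then have "Min (f ` X) \<le> f x" if "x \<in> S" for x
    using assms(4)[OF that] by (meson Min_le finite_imageI imageI order_trans)
  then show "Min (f ` X) \<le> Min (f ` S)"
    using assms by (intro Min.boundedI) auto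
qed

text \<open>The order on \<open>X\<close>, moved onto the index shape, is the order of some standard
  tableau there, and that tableau is the required witness.\<close>

lemma index_subtableau_restrict:
  assumes "finite X" "X \<noteq> {}" "linked X" "X \<subseteq> S" "translate t X = index_shape P w"
    and "partial_tableau S \<tau>"
  shows "index_subtableau P w \<tau> (\<tau> |` X)"
proof -
  have pt: "partial_tableau X (\<tau> |` X)"
    using assms by (intro partial_tableau_restrict)
  have fin: "finite (index_shape P w)"
    using assms(1,5) by (metis finite_translate)
  have "shift_rel t (tableau_order (\<tau> |` X)) \<in> linear_extensions (index_shape P w)"
    using shift_rel_in_linear_extensions[OF tableau_order_in_linear_extensions[OF pt], of t] assms(5) by simp
  then obtain \<xi> where xi: "\<xi> \<in> SYT (index_shape P w)"
    "tableau_order \<xi> = shift_rel t (tableau_order (\<tau> |` X))"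
    using bij_betw_imp_surj_on[OF tableau_order_bij[OF fin]] by (metis imageE)
  then have "partial_tableau (translate t X) \<xi>"
    using assms(5) by (simp add: SYT_def)
  then have "tg_iso (Tb (\<tau> |` X)) (Tb \<xi>)"
    using tg_iso_iff[OF assms(1-3) pt] xi by blast
  moreover have "X \<subseteq> dom \<tau>"
    using assms by (simp add: partial_tableau_def)
  ultimately show ?thesis
    using xi unfolding index_subtableau_def by blast
qed

text \<open>The vertex set of a tableau graph is the whole domain, so an isomorphism forces the
  domain to be a translate of the index shape.\<close>

lemma index_subtableau_shape:
  assumes "translate t X = index_shape P w" "partial_tableau S \<tau>" "index_subtableau P w \<tau> \<sigma>"
  obtains s where "translate s X \<subseteq> S" "\<sigma> = \<tau> |` translate s X" "dom \<sigma> = translate s X"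
proof -
  obtain Y \<xi> where Y: "Y \<subseteq> dom \<tau>" "\<sigma> = \<tau> |` Y" and xi: "\<xi> \<in> SYT (index_shape P w)" "tg_iso (Tb \<sigma>) (Tb \<xi>)"
    using assms(3) unfolding index_subtableau_def by blast
  have "dom \<sigma> = Y"
    using Y by auto
  moreover have "dom \<xi> = translate t X"
    using xi(1) assms(1) by (simp add: SYT_def partial_tableau_def)
  ultimately obtain s where "translate s Y = translate t X"
    using xi(2) unfolding tg_iso_def by (auto simp: Tb_def)
  then have "Y = translate (- s + t) X"
    by (metis (no_types) add.left_inverse translate_0 translate_translate)
  then show ?thesis
    using that Y assms(2) \<open>dom \<sigma> = Y\<close> by (simp add: partial_tableau_def)
qed

text \<open>Only translates of \<open>X\<close> compete, and \<open>X\<close> itself qualifies.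
  Agreement of the lowest row and of the right-most column leaves no room for a nonzero
  shift.\<close>

lemma bottom_index_tableau_eq:
  assumes X: "finite S" "X \<noteq> {}" "linked X" "X \<subseteq> S" "translate t X = index_shape P w"
    and pt: "partial_tableau S \<tau>"
    and "\<And>x. x \<in> S \<Longrightarrow> \<exists>y\<in>X. fst x \<le> fst y" "\<And>x. x \<in> S \<Longrightarrow> \<exists>y\<in>X. snd x \<le> snd y"
  shows "bottom_index_tableau P w \<tau> = \<tau> |` X"
  unfolding bottom_index_tableau_def
proof (rule the_equality)
  have dom: "dom \<tau> = S"
    using pt by (simp add: partial_tableau_def)
  have finX: "finite X"
    using X finite_subset by blast
  have mx: "Max (fst ` X) = Max (fst ` S)" "Max (snd ` X) = Max (snd ` S)"
    using Max_image_eq_subset[OF X(1,4,2)] assms(7,8) by auto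
  have "dom (\<tau> |` X) = X"
    using X dom by auto
  then show "index_subtableau P w \<tau> (\<tau> |` X) \<and> bottom_row (dom (\<tau> |` X)) \<subseteq> bottom_row (dom \<tau>) \<and>
      rightmost_column (dom (\<tau> |` X)) \<subseteq> rightmost_column (dom \<tau>)"
    using index_subtableau_restrict[OF finX X(2-5) pt] mx dom
      bottom_row_subset_iff[OF X(1,4,2)] rightmost_column_subset_iff[OF X(1,4,2)] by simp
  fix \<sigma>
  assume *: "index_subtableau P w \<tau> \<sigma> \<and> bottom_row (dom \<sigma>) \<subseteq> bottom_row (dom \<tau>) \<and>
      rightmost_column (dom \<sigma>) \<subseteq> rightmost_column (dom \<tau>)"
  then obtain s where s: "translate s X \<subseteq> S" "\<sigma> = \<tau> |` translate s X" "dom \<sigma> = translate s X"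
    using index_subtableau_shape[OF X(5) pt] by blast
  have "translate s X \<noteq> {}"
    using X by simp
  then have "Max (fst ` translate s X) = Max (fst ` S)" "Max (snd ` translate s X) = Max (snd ` S)"
    using * s dom bottom_row_subset_iff[OF X(1) s(1)] rightmost_column_subset_iff[OF X(1) s(1)] by simp_all
  then have "s = 0"
    using mx Max_Min_translate(1,2)[OF finX X(2), of s] by (simp add: prod_eq_iff)
  then show "\<sigma> = \<tau> |` X"
    using s by simp
qed

lemma top_index_tableau_eq:
  assumes X: "finite S" "X \<noteq> {}" "linked X" "X \<subseteq> S" "translate t X = index_shape P w"
    and pt: "partial_tableau S \<tau>"
    and "\<And>x. x \<in> S \<Longrightarrow> \<exists>y\<in>X. fst y \<le> fst x" "\<And>x. x \<in> S \<Longrightarrow> \<exists>y\<in>X. snd y \<le> snd x"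
  shows "top_index_tableau P w \<tau> = \<tau> |` X"
  unfolding top_index_tableau_def
proof (rule the_equality)
  have dom: "dom \<tau> = S"
    using pt by (simp add: partial_tableau_def)
  have finX: "finite X"
    using X finite_subset by blast
  have mn: "Min (fst ` X) = Min (fst ` S)" "Min (snd ` X) = Min (snd ` S)"
    using Min_image_eq_subset[OF X(1,4,2)] assms(7,8) by auto
  have "dom (\<tau> |` X) = X"
    using X dom by auto
  then show "index_subtableau P w \<tau> (\<tau> |` X) \<and> top_row (dom (\<tau> |` X)) \<subseteq> top_row (dom \<tau>) \<and>
      leftmost_column (dom (\<tau> |` X)) \<subseteq> leftmost_column (dom \<tau>)"
    using index_subtableau_restrict[OF finX X(2-5) pt] mn dom
      top_row_subset_iff[OF X(1,4,2)] leftmost_column_subset_iff[OF X(1,4,2)] by simp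
  fix \<sigma>
  assume *: "index_subtableau P w \<tau> \<sigma> \<and> top_row (dom \<sigma>) \<subseteq> top_row (dom \<tau>) \<and>
      leftmost_column (dom \<sigma>) \<subseteq> leftmost_column (dom \<tau>)"
  then obtain s where s: "translate s X \<subseteq> S" "\<sigma> = \<tau> |` translate s X" "dom \<sigma> = translate s X"
    using index_subtableau_shape[OF X(5) pt] by blast
  have "translate s X \<noteq> {}"
    using X by simp
  then have "Min (fst ` translate s X) = Min (fst ` S)" "Min (snd ` translate s X) = Min (snd ` S)"
    using * s dom top_row_subset_iff[OF X(1) s(1)] leftmost_column_subset_iff[OF X(1) s(1)] by simp_all
  then have "s = 0"
    using mn Max_Min_translate(3,4)[OF finX X(2), of s] by (simp add: prod_eq_iff)
  then show "\<sigma> = \<tau> |` X"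
    using s by simp
qed

lemma tg_iso_restrict_iff:
  assumes "finite X" "X \<noteq> {}" "linked X" "X \<subseteq> S" "translate t X = I"
    and "partial_tableau S \<tau>" "\<xi> \<in> SYT I"
  shows "tg_iso (Tb (\<tau> |` X)) (Tb \<xi>) \<longleftrightarrow>
    shift_rel t (tableau_order \<tau> \<inter> X \<times> X) = tableau_order \<xi>"
  using tg_iso_iff[OF assms(1-3) partial_tableau_restrict[OF assms(6,4)], of t \<xi>] assms(5,7)
  by (auto simp: SYT_def tableau_order_restrict)

section \<open>Gluing linear extensions\<close>

text \<open>All pairs of \<open>A \<times> B\<close> are forced because \<open>u\<close> lies in
  between. The substance is transitivity: chains that pass between the two pieces are decided by
  comparison with \<open>u\<close>.\<close>

lemma glue_in_linear_extensions:
  assumes disj: "A \<inter> D = {}" "D \<inter> B = {}" "A \<inter> B = {}"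
    and r: "r \<in> linear_extensions (A \<union> D)" and g: "g \<in> linear_extensions (D \<union> B)"
    and agree: "r \<inter> D \<times> D = g \<inter> D \<times> D"
    and u: "u \<in> D" "\<And>a. a \<in> A \<Longrightarrow> (a, u) \<in> r" "\<And>b. b \<in> B \<Longrightarrow> (u, b) \<in> g"
    and no_step: "\<And>a b. a \<in> A \<Longrightarrow> b \<in> B \<Longrightarrow> a - b \<notin> {(0, 1), (1, 0)}"
  shows "r \<union> g \<union> A \<times> B \<in> linear_extensions (A \<union> D \<union> B)"
proof -
  have r': "r \<subseteq> (A \<union> D) \<times> (A \<union> D)" "trans r" "irrefl r" "total_on (A \<union> D) r"
    and step_r: "\<And>p d. p \<in> A \<union> D \<Longrightarrow> d \<in> {(0, 1), (1, 0)} \<Longrightarrow> p + d \<in> A \<union> D \<Longrightarrow> (p, p + d) \<in> r"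
    using r by (auto simp: linear_extensions_def)
  have g': "g \<subseteq> (D \<union> B) \<times> (D \<union> B)" "trans g" "irrefl g" "total_on (D \<union> B) g"
    and step_g: "\<And>p d. p \<in> D \<union> B \<Longrightarrow> d \<in> {(0, 1), (1, 0)} \<Longrightarrow> p + d \<in> D \<union> B \<Longrightarrow> (p, p + d) \<in> g"
    using g by (auto simp: linear_extensions_def)
  have D_iff: "(x, y) \<in> r \<longleftrightarrow> (x, y) \<in> g" if "x \<in> D" "y \<in> D" for x y
    using agree that by blast
  let ?R = "r \<union> g \<union> A \<times> B"
  have in_r: "(x, y) \<in> r" if "(x, y) \<in> ?R" "x \<in> A \<union> D" "y \<in> A \<union> D" for x y
    using that disj g'(1) D_iff by blast
  have in_g: "(x, y) \<in> g" if "(x, y) \<in> ?R" "x \<in> D \<union> B" "y \<in> D \<union> B" for x y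
    using that disj r'(1) D_iff by blast
  have no_BA: "(x, y) \<notin> ?R" if "x \<in> B" "y \<in> A" for x y
    using that disj r'(1) g'(1) by blast
  have "trans ?R"
  proof (rule transI)
    fix x y z assume xy: "(x, y) \<in> ?R" and yz: "(y, z) \<in> ?R"
    have S: "x \<in> A \<union> D \<union> B" "y \<in> A \<union> D \<union> B" "z \<in> A \<union> D \<union> B"
      using xy yz r'(1) g'(1) by blast+
    \<comment> \<open>Triples inside one piece are settled there. Among those meeting both
      \<open>A\<close> and \<open>B\<close>, the third kind is in the product, the fourth, seventh
      and eighth cannot occur, and the fifth and sixth are compared with \<open>u\<close>.\<close>
    consider "x \<in> A \<union> D" "y \<in> A \<union> D" "z \<in> A \<union> D" | "x \<in> D \<union> B" "y \<in> D \<union> B" "z \<in> D \<union> B"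
      | "x \<in> A" "z \<in> B" | "x \<in> B" "y \<in> D" "z \<in> A" | "x \<in> D" "y \<in> A" "z \<in> B" | "x \<in> A" "y \<in> B" "z \<in> D"
      | "x \<in> B" "y \<in> A" | "y \<in> B" "z \<in> A"
      using S by blast
    then show "(x, z) \<in> ?R"
    proof cases
      case 1
      then show ?thesis
        using in_r[OF xy] in_r[OF yz] transD[OF r'(2)] by blast
    next
      case 2
      then show ?thesis
        using in_g[OF xy] in_g[OF yz] transD[OF g'(2)] by blast
    next
      case 4
      \<comment> \<open>\<open>y\<close>, \<open>z\<close>, \<open>u\<close> would be a chain in
        \<open>r\<close> and \<open>u\<close>, \<open>x\<close>, \<open>y\<close> one in
        \<open>g\<close>, although both orders agree on \<open>D\<close>.\<close>
      have "(y, u) \<in> r"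
        using in_r[OF yz] u(2)[of z] 4 transD[OF r'(2)] by blast
      then have "(y, u) \<in> g"
        using D_iff 4 u(1) by blast
      moreover have "(u, y) \<in> g"
        using in_g[OF xy] u(3)[of x] 4 transD[OF g'(2)] by blast
      ultimately show ?thesis
        using transD[OF g'(2)] irreflD[OF g'(3)] by blast
    next
      case 5
      have "(x, u) \<in> r"
        using in_r[OF xy] u(2)[of y] 5 transD[OF r'(2)] by blast
      then show ?thesis
        using D_iff 5 u(1) u(3)[of z] transD[OF g'(2)] by blast
    next
      case 6
      have "(u, z) \<in> g"
        using in_g[OF yz] u(3)[of y] 6 transD[OF g'(2)] by blast
      then show ?thesis
        using D_iff 6 u(1) u(2)[of x] transD[OF r'(2)] by blast
    qed (use xy yz no_BA in blast)+
  qed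
  moreover have "irrefl ?R"
    using irreflD[OF r'(3)] irreflD[OF g'(3)] disj(3) by (intro irreflI) blast
  moreover have "total_on (A \<union> D \<union> B) ?R"
    using r'(4) g'(4) unfolding total_on_def by blast
  moreover have "(p, p + d) \<in> ?R"
    if "p \<in> A \<union> D \<union> B" "d \<in> {(0, 1), (1, 0)}" "p + d \<in> A \<union> D \<union> B" for p d
  proof -
    \<comment> \<open>Steps from \<open>A\<close> to \<open>B\<close> are in the product; only a
      step from \<open>B\<close> to \<open>A\<close> could be missing.\<close>
    have "\<not> (p \<in> B \<and> p + d \<in> A)"
      using no_step[of "p + d" p] that(2) by auto
    then show ?thesis
      using step_r[of p d] step_g[of p d] that by blast
  qed
  moreover have "?R \<subseteq> (A \<union> D \<union> B) \<times> (A \<union> D \<union> B)"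
    using r'(1) g'(1) by blast
  ultimately show ?thesis
    unfolding linear_extensions_def by blast
qed

text \<open>An extension is recovered from its two restrictions, since the pairs between
  \<open>A\<close> and \<open>B\<close> are forced. The condition \<open>Q\<close> sees only the
  lower piece; it will fix the trace on the next index part, which may reach into both
  \<open>D\<close> and \<open>B\<close>.\<close>

lemma card_glue:
  assumes fin: "finite (A \<union> D \<union> B)"
    and disj: "A \<inter> D = {}" "D \<inter> B = {}" "A \<inter> B = {}"
    and u: "u \<in> D" "\<And>r a. r \<in> linear_extensions (A \<union> D) \<Longrightarrow> a \<in> A \<Longrightarrow> (a, u) \<in> r"
      "\<And>g b. g \<in> linear_extensions (D \<union> B) \<Longrightarrow> b \<in> B \<Longrightarrow> (u, b) \<in> g"
    and no_step: "\<And>a b. a \<in> A \<Longrightarrow> b \<in> B \<Longrightarrow> a - b \<notin> {(0, 1), (1, 0)}"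
  shows "card {r \<in> linear_extensions (A \<union> D \<union> B). r \<inter> D \<times> D = d \<and> Q (r \<inter> (D \<union> B) \<times> (D \<union> B))} =
    card {r \<in> linear_extensions (A \<union> D). r \<inter> D \<times> D = d} *
    card {g \<in> linear_extensions (D \<union> B). g \<inter> D \<times> D = d \<and> Q g}"
    (is "card ?L = card ?R * card ?G")
proof -
  let ?f = "\<lambda>r. (r \<inter> (A \<union> D) \<times> (A \<union> D), r \<inter> (D \<union> B) \<times> (D \<union> B))"
  have split: "s = s \<inter> (A \<union> D) \<times> (A \<union> D) \<union> s \<inter> (D \<union> B) \<times> (D \<union> B) \<union> A \<times> B"
    if s: "s \<in> linear_extensions (A \<union> D \<union> B)" for s
  proof -
    have s': "s \<subseteq> (A \<union> D \<union> B) \<times> (A \<union> D \<union> B)" "trans s" "irrefl s"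
      using s by (auto simp: linear_extensions_def)
    have "s \<inter> (A \<union> D) \<times> (A \<union> D) \<in> linear_extensions (A \<union> D)"
      "s \<inter> (D \<union> B) \<times> (D \<union> B) \<in> linear_extensions (D \<union> B)"
      using s by (auto intro: linear_extensions_restrict)
    then have AB: "(a, b) \<in> s" if "a \<in> A" "b \<in> B" for a b
      using u(2)[of _ a] u(3)[of _ b] that transD[OF s'(2), of a u b] by blast
    then have "(b, a) \<notin> s" if "a \<in> A" "b \<in> B" for a b
      using that transD[OF s'(2)] irreflD[OF s'(3)] by blast
    with AB s'(1) show ?thesis
      by blast
  qed
  have inj: "inj_on ?f ?L"
  proof (rule inj_onI)
    fix x y assume "x \<in> ?L" "y \<in> ?L" "?f x = ?f y"
    then show "x = y"
      using split[of x] split[of y] by (metis (no_types, lifting) Pair_inject mem_Collect_eq)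
  qed
  have img: "?f ` ?L = ?R \<times> ?G"
  proof
    show "?f ` ?L \<subseteq> ?R \<times> ?G"
    proof
      fix z assume "z \<in> ?f ` ?L"
      then obtain s where s: "s \<in> ?L" "z = ?f s"
        by blast
      moreover have "s \<inter> (A \<union> D) \<times> (A \<union> D) \<inter> D \<times> D = s \<inter> D \<times> D"
        "s \<inter> (D \<union> B) \<times> (D \<union> B) \<inter> D \<times> D = s \<inter> D \<times> D"
        by blast+
      ultimately show "z \<in> ?R \<times> ?G"
        using linear_extensions_restrict[of s "A \<union> D \<union> B" "A \<union> D"]
          linear_extensions_restrict[of s "A \<union> D \<union> B" "D \<union> B"] by auto
    qed
    show "?R \<times> ?G \<subseteq> ?f ` ?L"
    proof
      fix z assume "z \<in> ?R \<times> ?G"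
      then obtain r g where z: "z = (r, g)" and r: "r \<in> linear_extensions (A \<union> D)" "r \<inter> D \<times> D = d"
        and g: "g \<in> linear_extensions (D \<union> B)" "g \<inter> D \<times> D = d" "Q g"
        by blast
      let ?s = "r \<union> g \<union> A \<times> B"
      have sub: "r \<subseteq> (A \<union> D) \<times> (A \<union> D)" "g \<subseteq> (D \<union> B) \<times> (D \<union> B)"
        using r g by (auto simp: linear_extensions_def)
      have s: "?s \<in> linear_extensions (A \<union> D \<union> B)"
        using glue_in_linear_extensions[OF disj r(1) g(1)] r g u no_step by blast
      \<comment> \<open>Pairs of \<open>g\<close> within \<open>A \<union> D\<close> lie in
        \<open>D\<close>, where the orders coincide, so restricting the union gives back exactly
        \<open>r\<close>.\<close>
      have in_r: "(x, y) \<in> r" if "(x, y) \<in> g" "x \<in> A \<union> D" "y \<in> A \<union> D" for x y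
      proof -
        have "x \<in> D" "y \<in> D"
          using that sub disj by blast+
        then show ?thesis
          using that(1) r(2) g(2) by blast
      qed
      have in_g: "(x, y) \<in> g" if "(x, y) \<in> r" "x \<in> D \<union> B" "y \<in> D \<union> B" for x y
      proof -
        have "x \<in> D" "y \<in> D"
          using that sub disj by blast+
        then show ?thesis
          using that(1) r(2) g(2) by blast
      qed
      have no_AB: "A \<times> B \<inter> (A \<union> D) \<times> (A \<union> D) = {}" "A \<times> B \<inter> (D \<union> B) \<times> (D \<union> B) = {}"
        "A \<times> B \<inter> D \<times> D = {}"
        using disj by blast+
      have "?s \<inter> (A \<union> D) \<times> (A \<union> D) = r"
        unfolding Int_Un_distrib2 no_AB using in_r sub(1) by blast
      moreover have "?s \<inter> (D \<union> B) \<times> (D \<union> B) = g"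
        unfolding Int_Un_distrib2 no_AB using in_g sub(2) by blast
      moreover have "?s \<inter> D \<times> D = d"
        unfolding Int_Un_distrib2 no_AB using r(2) g(2) by blast
      ultimately have "?f ?s = z" "?s \<in> ?L"
        using s g(3) unfolding z by (simp_all only: mem_Collect_eq)
      then show "z \<in> ?f ` ?L"
        by (rule rev_image_eqI[OF _ sym, rotated])
    qed
  qed
  have "card ?L = card (?f ` ?L)"
    by (rule card_image[OF inj, symmetric])
  also have "\<dots> = card ?R * card ?G"
    unfolding img by (rule card_cartesian_product)
  finally show ?thesis .
qed

section \<open>Periodic shapes\<close>

lemma fst_scale [simp]: "fst (scale k p) = int k * fst p"
  and snd_scale [simp]: "snd (scale k p) = int k * snd p"
  by (simp_all add: scale_def)

lemma scale_0 [simp]: "scale 0 p = 0"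
  by (simp add: prod_eq_iff)

lemma scale_add: "scale (i + j) p = scale i p + scale j p"
  by (simp add: prod_eq_iff algebra_simps)

lemma scale_Suc: "scale (Suc k) p = p + scale k p"
  by (simp add: prod_eq_iff algebra_simps)

lemma topleft_cell_in:
  assumes "finite S" "S \<noteq> {}"
  shows "topleft_cell S \<in> S"
proof -
  have "Min (fst ` S) \<in> fst ` S"
    using assms by simp
  then have "top_row S \<noteq> {}"
    unfolding top_row_def by force
  moreover have "finite (top_row S)"
    using assms by (simp add: top_row_def)
  ultimately have "Min (snd ` top_row S) \<in> snd ` top_row S"
    by simp
  then obtain x where "x \<in> top_row S" "snd x = Min (snd ` top_row S)"
    by (metis imageE)
  then have "x \<in> S" "x = topleft_cell S"
    by (simp_all add: top_row_def topleft_cell_def prod_eq_iff)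
  then show ?thesis
    by simp
qed

lemma bottomleft_cell_in:
  assumes "finite S" "S \<noteq> {}"
  shows "bottomleft_cell S \<in> S"
proof -
  have "Max (fst ` S) \<in> fst ` S"
    using assms by simp
  then have "bottom_row S \<noteq> {}"
    unfolding bottom_row_def by force
  moreover have "finite (bottom_row S)"
    using assms by (simp add: bottom_row_def)
  ultimately have "Min (snd ` bottom_row S) \<in> snd ` bottom_row S"
    by simp
  then obtain x where "x \<in> bottom_row S" "snd x = Min (snd ` bottom_row S)"
    by (metis imageE)
  then have "x \<in> S" "x = bottomleft_cell S"
    by (simp_all add: bottom_row_def bottomleft_cell_def prod_eq_iff)
  then show ?thesis
    by simp
qed

text \<open>Were \<open>x\<close> further left, convexity would put the cell of the top row in the
  column of \<open>x\<close> into \<open>S\<close>, to the left of the first cell of that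
  row.\<close>

lemma topleft_cell_le_snd:
  assumes "finite S" "ne_convex S" "x \<in> S"
  shows "snd (topleft_cell S) \<le> snd x"
proof (rule ccontr)
  assume less: "\<not> ?thesis"
  have "S \<noteq> {}"
    using assms(3) by blast
  then have tl: "topleft_cell S \<in> S"
    using topleft_cell_in[OF assms(1)] by blast
  have "fst (topleft_cell S) \<le> fst x"
    using assms by (simp add: topleft_cell_def)
  then have "(fst (topleft_cell S), snd x) \<in> S"
    using ne_convexD[OF assms(2,3) tl, of "(fst (topleft_cell S), snd x)"] less by simp
  then have "(fst (topleft_cell S), snd x) \<in> top_row S"
    by (simp add: top_row_def topleft_cell_def)
  moreover have "finite (top_row S)"
    using assms(1) by (simp add: top_row_def)
  ultimately have "Min (snd ` top_row S) \<le> snd x"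
    by (metis Min_le finite_imageI imageI snd_conv)
  then show False
    using less by (simp add: topleft_cell_def)
qed

section \<open>Blocks of a compatible pair\<close>

locale compatible_pair =
  fixes P :: "cell set" and w :: nat
  assumes compat: "compatible P w"
begin

abbreviation period :: cell where
  "period \<equiv> nabla P w"

abbreviation block :: "nat \<Rightarrow> cell set" where
  "block k \<equiv> translate (scale k period) P"

lemma P_props: "finite P" "P \<noteq> {}" "ne_convex P"
  using compat unfolding compatible_def periodic_shape_def
  by (auto intro: ne_convex_skew_diagram)

lemma Sh_props: "finite (Sh P w n)" "linked (Sh P w n)"
  using compat unfolding compatible_def periodic_shape_def
  by (auto intro: ne_convex_connected_linked ne_convex_skew_diagram)

lemma Sh_Suc: "Sh P w (Suc n) = Sh P w n \<union> block (Suc n)"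
  unfolding Sh_def atMost_Suc by (simp add: Un_commute)

lemma Sh_0: "Sh P w 0 = P"
  by (simp add: Sh_def)

text \<open>Adds the new block at the top end instead of the bottom end; this recursion is what
  compares consecutive index parts.\<close>

lemma Sh_Suc_shift: "Sh P w (Suc n) = P \<union> translate period (Sh P w n)"
proof (induction n)
  case 0
  then show ?case
    by (simp add: Sh_Suc Sh_0 scale_Suc)
next
  case (Suc n)
  have "translate period (Sh P w (Suc n)) = translate period (Sh P w n) \<union> block (Suc (Suc n))"
    by (auto simp: Sh_Suc scale_Suc[of "Suc n"] diff_diff_eq)
  then show ?case
    using Suc Sh_Suc[of "Suc n"] by auto
qed

lemma Sh_mono: "m \<le> n \<Longrightarrow> Sh P w m \<subseteq> Sh P w n"
  unfolding Sh_def by (intro UN_mono) auto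

lemma block_subset_Sh: "block n \<subseteq> Sh P w n"
  unfolding Sh_def by blast

definition first_row :: int where
  "first_row = fst (topleft_cell P)"

abbreviation height :: int where
  "height \<equiv> fst period"

abbreviation width :: int where
  "width \<equiv> snd period"

text \<open>The summand \<open>(1, w)\<close> in \<open>nabla\<close> makes its row component the
  number of rows of \<open>P\<close>, so successive blocks occupy disjoint, consecutive bands of
  rows.\<close>

lemma P_rows:
  assumes "x \<in> P"
  shows "first_row \<le> fst x" "fst x < first_row + height"
  using assms P_props by (auto simp: first_row_def nabla_def topleft_cell_def bottomleft_cell_def
      intro: order.strict_trans1[OF Max_ge])

lemma height_pos: "0 < height"
  using P_rows P_props(2) by fastforce

lemma P_columns: "x \<in> P \<Longrightarrow> snd (topleft_cell P) \<le> snd x"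
  using topleft_cell_le_snd P_props by blast

lemma block_rows:
  assumes "x \<in> block k"
  shows "first_row + int k * height \<le> fst x" "fst x < first_row + int (Suc k) * height"
  using P_rows[of "x - scale k period"] assms by (simp_all add: algebra_simps)

lemma Sh_rows:
  assumes "x \<in> Sh P w n"
  shows "first_row \<le> fst x" "fst x < first_row + int (Suc n) * height"
proof -
  obtain k where k: "k \<le> n" "x \<in> block k"
    using assms unfolding Sh_def by blast
  have "0 \<le> int k * height" "int (Suc k) * height \<le> int (Suc n) * height"
    using height_pos k(1) by (simp_all add: mult_right_mono)
  then show "first_row \<le> fst x" "fst x < first_row + int (Suc n) * height"
    using block_rows[OF k(2)] by linarith+
qed

lemma Sh_above:
  assumes "x \<in> Sh P w m" "fst x < first_row + int (Suc n) * height"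
  shows "x \<in> Sh P w n"
proof -
  obtain k where k: "k \<le> m" "x \<in> block k"
    using assms unfolding Sh_def by blast
  have "int k * height < int (Suc n) * height"
    using block_rows(1)[OF k(2)] assms(2) by linarith
  then have "k \<le> n"
    using height_pos by (simp add: mult_less_cancel_right)
  then show ?thesis
    using k(2) unfolding Sh_def by blast
qed

text \<open>With zero width the top left cells of the \<open>B + 1\<close> blocks of
  \<open>Sh P w B\<close> would share a column, against the bound \<open>B\<close> on column
  sizes.\<close>

lemma width_pos: "0 < width"
proof (rule ccontr)
  assume "\<not> 0 < width"
  moreover have "0 \<le> width"
    using P_columns[OF bottomleft_cell_in] P_props by (simp add: nabla_def)
  ultimately have width0: "width = 0"
    by linarith
  obtain B where B: "card {p \<in> Sh P w n. snd p = c} \<le> B" for n c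
    using compat unfolding compatible_def by blast
  let ?f = "\<lambda>i. topleft_cell P + scale i period"
  have "inj_on ?f {..B}"
    using height_pos by (auto simp: inj_on_def prod_eq_iff)
  moreover have "?f ` {..B} \<subseteq> {p \<in> Sh P w B. snd p = snd (topleft_cell P)}"
  proof -
    have "?f i \<in> block i" "snd (?f i) = snd (topleft_cell P)" for i
      using topleft_cell_in P_props width0 by simp_all
    then show ?thesis
      unfolding Sh_def by blast
  qed
  moreover have "finite {p \<in> Sh P w B. snd p = snd (topleft_cell P)}"
    using Sh_props by simp
  ultimately have "card {..B} \<le> card {p \<in> Sh P w B. snd p = snd (topleft_cell P)}"
    by (rule card_inj_on_le)
  then show False
    using B[of B "snd (topleft_cell P)"] by simp
qed

text \<open>The bottom left cell of the copy of the index shape inside \<open>Sh P w k\<close>; it lies directly above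
  the top left cell of the next block.\<close>

definition corner :: "nat \<Rightarrow> cell" where
  "corner k = topleft_cell P + scale (Suc k) period - (1, 0)"

lemma fst_corner: "fst (corner k) = first_row + int (Suc k) * height - 1"
  and snd_corner: "snd (corner k) = snd (topleft_cell P) + int (Suc k) * width"
  unfolding corner_def first_row_def by simp_all

text \<open>In \<open>Sh P w (Suc k)\<close> the top left cell of the last block has
  \<open>topleft_cell P\<close> to its north-west, hence a neighbour above or to the left. A left
  neighbour would belong to the same block and lie left of all its columns.\<close>

lemma corner_in_Sh: "corner k \<in> Sh P w k"
proof -
  let ?a = "topleft_cell P" and ?b = "topleft_cell P + scale (Suc k) period"
  have "?a \<in> P"
    using topleft_cell_in P_props by blast
  then have "?a \<in> Sh P w 0" "?b \<in> block (Suc k)"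
    by (simp_all add: Sh_0)
  then have in_Sh: "?a \<in> Sh P w (Suc k)" "?b \<in> Sh P w (Suc k)"
    using Sh_mono[of 0 "Suc k"] block_subset_Sh by blast+
  have le: "fst ?a < fst ?b" "snd ?a \<le> snd ?b"
    using height_pos width_pos by simp_all
  then have "?a \<noteq> ?b"
    by (metis order.irrefl)
  then have "?b - (1, 0) \<in> Sh P w (Suc k) \<or> ?b - (0, 1) \<in> Sh P w (Suc k)"
    by (rule linked_predecessor[OF Sh_props(2) in_Sh less_imp_le[OF le(1)] le(2)])
  moreover have "?b - (0, 1) \<notin> Sh P w (Suc k)"
  proof
    assume left: "?b - (0, 1) \<in> Sh P w (Suc k)"
    have "?b - (0, 1) \<notin> Sh P w k"
      using Sh_rows(2)[of "?b - (0, 1)" k] by (auto simp: first_row_def)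
    then have "?a - (0, 1) \<in> P"
      using left by (simp add: Sh_Suc algebra_simps)
    then show False
      using P_columns[of "?a - (0, 1)"] by simp
  qed
  ultimately have "corner k \<in> Sh P w (Suc k)"
    by (simp add: corner_def)
  then show ?thesis
    by (rule Sh_above) (simp add: fst_corner)
qed

text \<open>Untranslated versions of the index shape and the coefficient shape inside \<open>Sh P w k\<close> and
  \<open>Sh P w (Suc k)\<close>; for small \<open>k\<close> they may be truncated at the top.\<close>

definition index_part :: "nat \<Rightarrow> cell set" where
  "index_part k = {x \<in> Sh P w k. snd (corner k) \<le> snd x}"

definition coeff_part :: "nat \<Rightarrow> cell set" where
  "coeff_part k = {x \<in> Sh P w (Suc k). snd (corner k) \<le> snd x}"

lemma corner_in_index_part: "corner k \<in> index_part k"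
  by (simp add: index_part_def corner_in_Sh)

lemma index_part_nonempty: "index_part k \<noteq> {}"
  using corner_in_index_part by blast

lemma index_part_subset_Sh: "index_part k \<subseteq> Sh P w k"
  by (auto simp: index_part_def)

lemma finite_parts: "finite (index_part k)" "finite (coeff_part k)"
  by (simp_all add: index_part_def coeff_part_def Sh_props)

lemma linked_parts: "linked (index_part k)" "linked (coeff_part k)"
  unfolding index_part_def coeff_part_def by (intro linked_columns_ge Sh_props)+

text \<open>The corner is in the same column as the top left cell of the new block, which is the
  first column of that block.\<close>

lemma coeff_part_eq: "coeff_part k = index_part k \<union> block (Suc k)"
proof -
  have "snd (corner k) \<le> snd x" if "x \<in> block (Suc k)" for x
    using P_columns[of "x - scale (Suc k) period"] that by (simp add: snd_corner)
  then show ?thesis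
    unfolding coeff_part_def index_part_def Sh_Suc by blast
qed

lemma index_part_subset_coeff_part: "index_part k \<subseteq> coeff_part k"
  by (simp add: coeff_part_eq)

lemma index_part_Suc_subset: "index_part (Suc k) \<subseteq> coeff_part k"
  using width_pos by (auto simp: index_part_def coeff_part_def snd_corner algebra_simps)

text \<open>The row of \<open>corner k\<close> is the last one before block \<open>Suc k\<close>
  begins, so the row condition of \<open>Delta\<close> selects exactly
  \<open>Sh P w k\<close>.\<close>

lemma Delta_corner:
  assumes "k \<le> m"
  shows "Delta (Sh P w m) (corner k) = index_part k"
  using Sh_above[of _ m k] Sh_rows(2)[of _ k] Sh_mono[OF assms]
  unfolding Delta_def index_part_def fst_corner by force

text \<open>The penultimate copy in \<open>Sh P w (Suc k)\<close> has index \<open>k\<close>; adding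
  the period to its top left cell leads to block \<open>Suc k\<close>, and subtracting
  \<open>(1, 0)\<close> to the cell above.\<close>

lemma u_cell_Suc: "u_cell P w (Suc k) = corner k"
  using topleft_cell_translate[OF P_props(1,2)]
  by (simp add: u_cell_def v_cell_def penultimate_copy_def corner_def scale_Suc algebra_simps)

lemma index_shape_at_Suc: "index_shape_at P w (Suc k) = normalize_shape (index_part k)"
  by (simp add: index_shape_at_def u_cell_Suc Delta_corner)

lemma coeff_shape_at_Suc: "coeff_shape_at P w (Suc (Suc k)) = normalize_shape (coeff_part k)"
proof -
  have "corner (Suc k) - period = corner k"
    by (simp add: corner_def scale_Suc[of "Suc k"] algebra_simps)
  moreover have "index_part (Suc k) \<union> index_part k \<union> block (Suc k) = coeff_part k"
    using index_part_Suc_subset[of k] coeff_part_eq[of k] by blast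
  ultimately show ?thesis
    by (simp add: coeff_shape_at_def u_cell_Suc Delta_corner penultimate_copy_def)
qed

section \<open>Stabilization of the index and coefficient shapes\<close>

lemma corner_Suc: "corner (Suc k) = period + corner k"
  by (simp add: corner_def scale_Suc[of "Suc k"] algebra_simps)

text \<open>Up to the period, the only new cells are those of the first block that reach the columns
  of the corner; truncation at the top ends once there are none.\<close>

lemma index_part_Suc:
  "index_part (Suc k) = translate period (index_part k) \<union> {x \<in> P. snd (corner (Suc k)) \<le> snd x}"
  unfolding index_part_def Sh_Suc_shift corner_Suc by auto

text \<open>Required for all later indices, so that \<open>index_part n\<close> is already a
  translate of the eventual index shape.\<close>

definition steady :: "nat \<Rightarrow> bool" where
  "steady n \<longleftrightarrow> (\<forall>k\<ge>n. index_part (Suc k) = translate period (index_part k))"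

lemma steady_mono: "steady m \<Longrightarrow> m \<le> n \<Longrightarrow> steady n"
  unfolding steady_def by simp

lemma steady_exists: "\<exists>n. steady n"
proof -
  \<comment> \<open>The corner moves right by at least one column per period, so after as many
    periods as the column spread of \<open>P\<close> it has passed the first block.\<close>
  define n where "n = nat (Max (snd ` P) - snd (topleft_cell P))"
  have empty: "{x \<in> P. snd (corner (Suc k)) \<le> snd x} = {}" if "n \<le> k" for k
  proof -
    have "int k < int (Suc (Suc k)) * 1" "int (Suc (Suc k)) * 1 \<le> int (Suc (Suc k)) * width"
      using width_pos by (simp, intro mult_left_mono) auto
    moreover have "Max (snd ` P) - snd (topleft_cell P) \<le> int k"
      using that by (simp add: n_def)
    ultimately have "Max (snd ` P) < snd (corner (Suc k))"
      unfolding snd_corner by linarith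
    moreover have "snd x \<le> Max (snd ` P)" if "x \<in> P" for x
      using that P_props by simp
    ultimately show ?thesis
      by fastforce
  qed
  have "steady n"
    unfolding steady_def index_part_Suc by (intro allI impI) (simp only: empty Un_empty_right)
  then show ?thesis
    by blast
qed

lemma steady_index_part:
  assumes "steady n"
  shows "index_part (n + k) = translate (scale k period) (index_part n)"
proof (induction k)
  case (Suc k)
  have "index_part (n + Suc k) = translate period (index_part (n + k))"
    using assms by (simp add: steady_def)
  then show ?case
    using Suc by (simp add: translate_translate scale_Suc)
qed simp

lemma steady_coeff_part:
  assumes "steady n"
  shows "coeff_part (n + k) = translate (scale k period) (coeff_part n)"
proof -
  have "block (Suc (n + k)) = translate (scale k period) (block (Suc n))"
    by (simp add: translate_translate scale_add[symmetric] add.commute)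
  moreover have "translate t (X \<union> Y) = translate t X \<union> translate t Y" for t X Y
    by (simp add: translate_def image_Un)
  ultimately show ?thesis
    unfolding coeff_part_eq steady_index_part[OF assms] by simp
qed

text \<open>All later index parts are translates of \<open>index_part n\<close>, and normalization
  sends them to one and the same set, the eventual value.\<close>

lemma index_shape_translate:
  assumes "steady n"
  obtains t where "translate t (index_part n) = index_shape P w"
proof -
  have ne: "index_part n \<noteq> {}"
    by (rule index_part_nonempty)
  have "index_shape_at P w m = normalize_shape (index_part n)" if m: "Suc n \<le> m" for m
  proof -
    obtain k where "m = Suc (n + k)"
      using le_Suc_ex[OF m] by auto
    then show ?thesis
      using index_shape_at_Suc steady_index_part[OF assms] finite_parts ne
      by (simp add: normalize_shape_translate)
  qed
  then have "index_shape P w = normalize_shape (index_part n)"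
    unfolding index_shape_def by (rule eventual_value_eqI)
  then show ?thesis
    using that normalize_shape_eq[OF finite_parts(1) ne] by metis
qed

lemma coeff_shape_translate:
  assumes "steady n"
  obtains t where "translate t (coeff_part n) = coeff_shape P w"
proof -
  have ne: "coeff_part n \<noteq> {}"
    using corner_in_index_part coeff_part_eq by blast
  have "coeff_shape_at P w m = normalize_shape (coeff_part n)" if m: "Suc (Suc n) \<le> m" for m
  proof -
    obtain k where "m = Suc (Suc (n + k))"
      using le_Suc_ex[OF m] by auto
    then show ?thesis
      using coeff_shape_at_Suc steady_coeff_part[OF assms] finite_parts ne
      by (simp add: normalize_shape_translate)
  qed
  then have "coeff_shape P w = normalize_shape (coeff_part n)"
    unfolding coeff_shape_def by (rule eventual_value_eqI)
  then show ?thesis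
    using that normalize_shape_eq[OF finite_parts(2) ne] by metis
qed

text \<open>A translate of the index shape fits into \<open>Sh P w n\<close> only if that shape has enough rows, and
  then \<open>index_part n\<close> is not truncated at the top.\<close>

lemma steady_if_index_shape_fits:
  assumes fits: "translate s (index_shape P w) \<subseteq> Sh P w n"
  shows "steady n"
  unfolding steady_def
proof (intro allI impI)
  fix k assume k: "n \<le> k"
  have False if x: "x \<in> P" "snd (corner (Suc k)) \<le> snd x" for x
  proof -
    obtain m where m: "steady m"
      using steady_exists by blast
    \<comment> \<open>At \<open>j\<close> the index part is a full index shape, and it contains
      \<open>index_part (Suc k)\<close> moved by \<open>m\<close> periods.\<close>
    define j where "j = Suc k + m"
    have "steady j"
      using steady_mono[OF m] by (simp add: j_def)
    then obtain t where t: "translate t (index_part j) = index_shape P w"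
      using index_shape_translate by blast
    have sub: "translate (scale i period) (index_part (Suc k)) \<subseteq> index_part (Suc k + i)" for i
    proof (induction i)
      case (Suc i)
      have "translate (scale (Suc i) period) (index_part (Suc k))
          = translate period (translate (scale i period) (index_part (Suc k)))"
        by (simp add: translate_translate scale_Suc)
      also have "\<dots> \<subseteq> translate period (index_part (Suc k + i))"
        by (rule translate_mono[OF Suc.IH])
      also have "\<dots> \<subseteq> index_part (Suc k + Suc i)"
        using index_part_Suc by auto
      finally show ?case .
    qed simp
    have "x \<in> index_part (Suc k)"
      using x unfolding index_part_Suc by blast
    then have "x + scale m period \<in> index_part j"
      using subsetD[OF sub[of m], of "x + scale m period"] unfolding j_def by simp
    then have y: "s + (t + (x + scale m period)) \<in> Sh P w n" (is "?y \<in> _")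
      using fits unfolding t[symmetric] by (auto simp: translate_def)
    have z: "s + (t + corner j) \<in> Sh P w n" (is "?z \<in> _")
      using fits corner_in_index_part[of j] unfolding t[symmetric] by (auto simp: translate_def)
    \<comment> \<open>The images of \<open>x\<close>, a cell of the first block, and of the corner
      are at least \<open>Suc k\<close> heights apart, but the rows of \<open>Sh P w n\<close> span
      only \<open>Suc n\<close> heights.\<close>
    have "fst ?z - fst ?y = first_row + int (Suc j) * height - 1 - fst x - int m * height"
      by (simp add: fst_corner)
    also have "\<dots> = first_row + int (Suc (Suc k)) * height - 1 - fst x"
      by (simp add: j_def algebra_simps)
    also have "\<dots> \<ge> int (Suc k) * height"
      using P_rows(2)[OF x(1)] by (simp add: algebra_simps)
    finally have "int (Suc k) * height \<le> fst ?z - fst ?y" .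
    moreover have "fst ?z - fst ?y < int (Suc n) * height"
      using Sh_rows(1)[OF y] Sh_rows(2)[OF z] by linarith
    moreover have "int (Suc n) * height \<le> int (Suc k) * height"
      using k height_pos by (intro mult_right_mono) auto
    ultimately show False
      by linarith
  qed
  then show "index_part (Suc k) = translate period (index_part k)"
    unfolding index_part_Suc by blast
qed

lemma steady_index_N: "steady (index_N P w)"
proof -
  obtain m where m: "steady m"
    using steady_exists by blast
  then obtain t where "translate t (index_part m) = index_shape P w"
    using index_shape_translate by blast
  then have "translate (- t) (index_shape P w) = index_part m"
    by (metis add.left_inverse translate_0 translate_translate)
  then have "\<exists>t. translate t (index_shape P w) \<subseteq> Sh P w m"
    using index_part_subset_Sh by blast
  then have "\<exists>t. translate t (index_shape P w) \<subseteq> Sh P w (index_N P w)"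
    unfolding index_N_def by (rule LeastI)
  then show ?thesis
    using steady_if_index_shape_fits by blast
qed

end

section \<open>The transfer matrix recursion\<close>

lemma card_Collect_bij_betw:
  assumes "bij_betw f A B" "\<And>x. x \<in> A \<Longrightarrow> R x \<longleftrightarrow> Q (f x)"
  shows "card {x \<in> A. R x} = card {y \<in> B. Q y}"
proof -
  have "f ` {x \<in> A. R x} = {y \<in> B. Q y}"
    using assms by (auto simp: bij_betw_def)
  moreover have "inj_on f {x \<in> A. R x}"
    using assms(1) by (auto simp: bij_betw_def inj_on_def)
  ultimately show ?thesis
    by (metis card_image)
qed

text \<open>The trace on \<open>X\<close>, moved onto \<open>I\<close>, is the order of exactly one
  tableau of \<open>I\<close>, so the classes of equal trace are indexed by tableaux.\<close>

lemma card_Collect_linear_extensions_split: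
  assumes "finite S" "X \<subseteq> S" "translate s X = I"
  shows "card {r \<in> linear_extensions S. Q r} =
    (\<Sum>\<xi>\<in>SYT I. card {r \<in> linear_extensions S. Q r \<and> shift_rel s (r \<inter> X \<times> X) = tableau_order \<xi>})"
proof -
  let ?g = "\<lambda>r. shift_rel s (r \<inter> X \<times> X)"
  let ?A = "{r \<in> linear_extensions S. Q r}"
  have "finite X"
    using assms finite_subset by blast
  then have fin: "finite I"
    using assms(3) by auto
  have "?g ` ?A \<subseteq> linear_extensions I"
    using linear_extensions_restrict[OF _ assms(2)] shift_rel_in_linear_extensions assms(3) by blast
  then have "(\<Sum>r\<in>?A. 1) = (\<Sum>y\<in>linear_extensions I. \<Sum>r\<in>{r \<in> ?A. ?g r = y}. 1 :: nat)"
    using finite_linear_extensions[OF fin] finite_linear_extensions[OF assms(1)]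
    by (intro sum.group[symmetric]) auto
  also have "\<dots> = (\<Sum>\<xi>\<in>SYT I. \<Sum>r\<in>{r \<in> ?A. ?g r = tableau_order \<xi>}. 1 :: nat)"
    by (rule sum.reindex_bij_betw[OF tableau_order_bij[OF fin], symmetric])
  finally show ?thesis
    by (simp add: conj_assoc)
qed

lemma pow_mat_mult_vec_iterate:
  fixes M :: "'a :: comm_ring_1 mat"
  assumes "M \<in> carrier_mat d d" "\<And>n. v n \<in> carrier_vec d"
    and "\<And>n. n \<ge> m \<Longrightarrow> v (Suc n) = M *\<^sub>v v n"
  shows "v (m + k) = M ^\<^sub>m k *\<^sub>v v m"
  using assms(3)
\<comment> \<open>\<open>M ^\<^sub>m Suc k\<close> unfolds with the factor \<open>M\<close> on the
  right, so the first step of the recursion is split off and the start \<open>m\<close> must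
  vary.\<close>
proof (induction k arbitrary: m)
  case 0
  then show ?case
    using assms(1,2) by simp
next
  case (Suc k)
  have "v (m + Suc k) = M ^\<^sub>m k *\<^sub>v v (Suc m)"
    using Suc.IH[of "Suc m"] Suc.prems by simp
  also have "\<dots> = M ^\<^sub>m k *\<^sub>v (M *\<^sub>v v m)"
    using Suc.prems by simp
  also have "\<dots> = M ^\<^sub>m Suc k *\<^sub>v v m"
    using assoc_mult_mat_vec[OF pow_carrier_mat[OF assms(1)] assms(1,2), of k m] by simp
  finally show ?case .
qed

lemma sum_nth_distinct:
  assumes "distinct xs"
  shows "(\<Sum>i\<in>{0..<length xs}. f (xs ! i)) = (\<Sum>x\<in>set xs. f x)"
  using sum.reindex_bij_betw[OF bij_betw_nth[OF assms refl refl], of f]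
  by (simp add: atLeast0LessThan)

context compatible_pair
begin

definition order_count :: "nat \<Rightarrow> tableau \<Rightarrow> nat" where
  "order_count n \<xi> = card {\<tau> \<in> SYT (Sh P w n). tg_iso (Tb (bottom_index_tableau P w \<tau>)) (Tb \<xi>)}"

text \<open>Prepares \<open>bottom_index_tableau_eq\<close>: the corner is in the last row, and
  cells outside the index part lie to its left.\<close>

lemma index_part_bottom_right:
  assumes "x \<in> Sh P w n"
  shows "\<exists>y\<in>index_part n. fst x \<le> fst y" "\<exists>y\<in>index_part n. snd x \<le> snd y"
proof -
  show "\<exists>y\<in>index_part n. fst x \<le> fst y"
    using Sh_rows(2)[OF assms] corner_in_index_part fst_corner[of n]
    by (intro bexI[of _ "corner n"]) auto
  show "\<exists>y\<in>index_part n. snd x \<le> snd y"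
  proof (cases "x \<in> index_part n")
    case False
    then have "snd x \<le> snd (corner n)"
      using assms by (simp add: index_part_def)
    then show ?thesis
      using corner_in_index_part by blast
  qed blast
qed

text \<open>Prepares \<open>top_index_tableau_eq\<close>: the corner is in the first column of the
  coefficient part, and the cells of the new block lie below it.\<close>

lemma index_part_top_left:
  assumes "x \<in> coeff_part n"
  shows "\<exists>y\<in>index_part n. fst y \<le> fst x" "\<exists>y\<in>index_part n. snd y \<le> snd x"
proof -
  show "\<exists>y\<in>index_part n. fst y \<le> fst x"
  proof (cases "x \<in> index_part n")
    case False
    then have "x \<in> block (Suc n)"
      using assms coeff_part_eq by blast
    then have "fst (corner n) \<le> fst x"
      using block_rows(1)[of x "Suc n"] fst_corner[of n] by linarith
    then show ?thesis
      using corner_in_index_part by blast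
  qed blast
  show "\<exists>y\<in>index_part n. snd y \<le> snd x"
    using assms corner_in_index_part by (auto simp: coeff_part_def)
qed

lemma order_count_eq:
  assumes s: "translate s (index_part n) = index_shape P w" and xi: "\<xi> \<in> SYT (index_shape P w)"
  shows "order_count n \<xi> =
    card {r \<in> linear_extensions (Sh P w n).
      shift_rel s (r \<inter> index_part n \<times> index_part n) = tableau_order \<xi>}"
  unfolding order_count_def
proof (rule card_Collect_bij_betw[OF tableau_order_bij[OF Sh_props(1)]])
  fix \<tau> assume "\<tau> \<in> SYT (Sh P w n)"
  then have pt: "partial_tableau (Sh P w n) \<tau>"
    by (simp add: SYT_def)
  have "bottom_index_tableau P w \<tau> = \<tau> |` index_part n"
    using bottom_index_tableau_eq[OF Sh_props(1) index_part_nonempty linked_parts(1) index_part_subset_Sh s pt]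
      index_part_bottom_right by blast
  then show "tg_iso (Tb (bottom_index_tableau P w \<tau>)) (Tb \<xi>) \<longleftrightarrow>
    shift_rel s (tableau_order \<tau> \<inter> index_part n \<times> index_part n) = tableau_order \<xi>"
    using tg_iso_restrict_iff[OF finite_parts(1) index_part_nonempty linked_parts(1) index_part_subset_Sh s pt xi] by simp
qed

definition transfer_count :: "tableau \<Rightarrow> tableau \<Rightarrow> nat" where
  "transfer_count \<xi>' \<xi> = card {\<tau> \<in> SYT (coeff_shape P w).
     tg_iso (Tb (top_index_tableau P w \<tau>)) (Tb \<xi>) \<and>
     tg_iso (Tb (bottom_index_tableau P w \<tau>)) (Tb \<xi>')}"

text \<open>Within the coefficient part the top index tableau sits on \<open>index_part n\<close>
  and the bottom one on \<open>index_part (Suc n)\<close>. A matrix entry thus counts orders with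
  prescribed traces on two consecutive index parts.\<close>

lemma transfer_count_eq:
  assumes n: "steady n"
    and s: "translate s (index_part n) = index_shape P w"
    and s': "translate s' (index_part (Suc n)) = index_shape P w"
    and xi: "\<xi> \<in> SYT (index_shape P w)" "\<xi>' \<in> SYT (index_shape P w)"
  shows "transfer_count \<xi>' \<xi> =
    card {g \<in> linear_extensions (coeff_part n).
      shift_rel s (g \<inter> index_part n \<times> index_part n) = tableau_order \<xi> \<and>
      shift_rel s' (g \<inter> index_part (Suc n) \<times> index_part (Suc n)) = tableau_order \<xi>'}"
proof -
  obtain t where t: "translate t (coeff_part n) = coeff_shape P w"
    using coeff_shape_translate[OF n] .
  let ?X = "translate t (index_part n)" and ?Y = "translate t (index_part (Suc n))"
  let ?f = "\<lambda>\<tau>. shift_rel (- t) (tableau_order \<tau>)"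
  have fin: "finite (coeff_shape P w)"
    using finite_parts(2) unfolding t[symmetric] by simp
  have coeff_back: "translate (- t) (coeff_shape P w) = coeff_part n"
    unfolding t[symmetric] translate_translate by simp
  have bij: "bij_betw ?f (SYT (coeff_shape P w)) (linear_extensions (coeff_part n))"
    using bij_betw_trans[OF tableau_order_bij[OF fin] shift_rel_bij[of "- t"]]
    unfolding coeff_back by (simp add: comp_def)
  have X: "finite ?X" "?X \<noteq> {}" "linked ?X" "?X \<subseteq> coeff_shape P w" "translate (s - t) ?X = index_shape P w"
    using translate_mono[OF index_part_subset_coeff_part, of t n] s
    by (simp_all add: finite_parts linked_translate linked_parts index_part_nonempty t
        translate_translate del: mem_translate)
  have Y: "finite ?Y" "?Y \<noteq> {}" "linked ?Y" "?Y \<subseteq> coeff_shape P w" "translate (s' - t) ?Y = index_shape P w"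
    using translate_mono[OF index_part_Suc_subset, of t n] s'
    by (simp_all add: finite_parts linked_translate linked_parts index_part_nonempty t
        translate_translate del: mem_translate)
  have top_left: "\<exists>y\<in>?X. fst y \<le> fst x" "\<exists>y\<in>?X. snd y \<le> snd x" if x: "x \<in> coeff_shape P w" for x
  proof -
    have "x - t \<in> coeff_part n"
      using x unfolding t[symmetric] by simp
    then obtain y z where "y \<in> index_part n" "fst y \<le> fst (x - t)" "z \<in> index_part n" "snd z \<le> snd (x - t)"
      using index_part_top_left by blast
    then show "\<exists>y\<in>?X. fst y \<le> fst x" "\<exists>y\<in>?X. snd y \<le> snd x"
      by (intro bexI[of _ "t + y"] bexI[of _ "t + z"]; simp)+
  qed
  have bottom_right: "\<exists>y\<in>?Y. fst x \<le> fst y" "\<exists>y\<in>?Y. snd x \<le> snd y" if x: "x \<in> coeff_shape P w" for x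
  proof -
    have "x - t \<in> Sh P w (Suc n)"
      using x unfolding t[symmetric] by (simp add: coeff_part_def)
    then obtain y z where "y \<in> index_part (Suc n)" "fst (x - t) \<le> fst y"
      "z \<in> index_part (Suc n)" "snd (x - t) \<le> snd z"
      using index_part_bottom_right by blast
    then show "\<exists>y\<in>?Y. fst x \<le> fst y" "\<exists>y\<in>?Y. snd x \<le> snd y"
      by (intro bexI[of _ "t + y"] bexI[of _ "t + z"]; simp)+
  qed
  have shift: "shift_rel q (shift_rel (- t) r \<inter> Z \<times> Z) = shift_rel (q - t) (r \<inter> translate t Z \<times> translate t Z)"
    for q r Z
  proof -
    have "shift_rel (q - t) (r \<inter> translate t Z \<times> translate t Z)
        = shift_rel q (shift_rel (- t) (r \<inter> translate t Z \<times> translate t Z))"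
      by (simp add: shift_rel_shift_rel)
    also have "\<dots> = shift_rel q (shift_rel (- t) r \<inter> Z \<times> Z)"
      unfolding shift_rel_Int_Times translate_translate by simp
    finally show ?thesis
      by simp
  qed
  show ?thesis
    unfolding transfer_count_def
  proof (rule card_Collect_bij_betw[OF bij])
    fix \<tau> assume "\<tau> \<in> SYT (coeff_shape P w)"
    then have pt: "partial_tableau (coeff_shape P w) \<tau>"
      by (simp add: SYT_def)
    have "top_index_tableau P w \<tau> = \<tau> |` ?X"
      using top_index_tableau_eq[OF fin X(2-5) pt] top_left by blast
    moreover have "bottom_index_tableau P w \<tau> = \<tau> |` ?Y"
      using bottom_index_tableau_eq[OF fin Y(2-5) pt] bottom_right by blast
    ultimately show "tg_iso (Tb (top_index_tableau P w \<tau>)) (Tb \<xi>) \<and>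
        tg_iso (Tb (bottom_index_tableau P w \<tau>)) (Tb \<xi>') \<longleftrightarrow>
      shift_rel s (?f \<tau> \<inter> index_part n \<times> index_part n) = tableau_order \<xi> \<and>
      shift_rel s' (?f \<tau> \<inter> index_part (Suc n) \<times> index_part (Suc n)) = tableau_order \<xi>'"
      unfolding shift using tg_iso_restrict_iff[OF X pt xi(1)] tg_iso_restrict_iff[OF Y pt xi(2)] by simp
  qed
qed

lemma card_SYT_Sh:
  assumes "steady n"
  shows "card (SYT (Sh P w n)) = (\<Sum>\<xi>\<in>SYT (index_shape P w). order_count n \<xi>)"
proof -
  obtain s where s: "translate s (index_part n) = index_shape P w"
    using index_shape_translate[OF assms] .
  have "card (SYT (Sh P w n)) = card {r \<in> linear_extensions (Sh P w n). True}"
    using bij_betw_same_card[OF tableau_order_bij[OF Sh_props(1)]] by simp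
  also have "\<dots> = (\<Sum>\<xi>\<in>SYT (index_shape P w). order_count n \<xi>)"
    by (subst card_Collect_linear_extensions_split[OF Sh_props(1) index_part_subset_Sh s])
      (simp add: order_count_eq[OF s])
  finally show ?thesis .
qed

text \<open>Extensions of the larger shape are sorted by their trace on the old index part. The new
  index part lies inside the coefficient part, so prescribing its trace affects only the transfer
  factor.\<close>

lemma order_count_Suc:
  assumes n: "steady n" and xi': "\<xi>' \<in> SYT (index_shape P w)"
  shows "order_count (Suc n) \<xi>' =
    (\<Sum>\<xi>\<in>SYT (index_shape P w). transfer_count \<xi>' \<xi> * order_count n \<xi>)"
proof -
  obtain s where s: "translate s (index_part n) = index_shape P w"
    using index_shape_translate[OF n] .
  obtain s' where s': "translate s' (index_part (Suc n)) = index_shape P w"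
    using index_shape_translate[OF steady_mono[OF n]] by (metis le_SucI order_refl)
  let ?A = "Sh P w n - index_part n" and ?D = "index_part n" and ?B = "block (Suc n)"
    and ?D' = "index_part (Suc n)" and ?u = "corner n"
  have AD: "?A \<union> ?D = Sh P w n" and DB: "?D \<union> ?B = coeff_part n" and ADB: "?A \<union> ?D \<union> ?B = Sh P w (Suc n)"
    using index_part_subset_Sh by (auto simp: coeff_part_eq Sh_Suc)
  \<comment> \<open>Cells of \<open>?A\<close> are weakly north-west and cells of \<open>?B\<close>
    weakly south-east of the corner, so \<open>linked_less\<close> supplies the comparisons that
    gluing demands.\<close>
  have row_A: "fst a \<le> fst ?u" "snd a < snd ?u" if "a \<in> ?A" for a
    using that Sh_rows(2)[of a n] fst_corner[of n] by (auto simp: index_part_def)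
  have row_D: "fst d \<le> fst ?u" if "d \<in> ?D" for d
    using that Sh_rows(2)[of d n] fst_corner[of n] by (auto simp: index_part_def)
  have row_B: "fst ?u < fst b" "snd ?u \<le> snd b" if "b \<in> ?B" for b
  proof -
    have "b \<in> coeff_part n"
      using that coeff_part_eq by blast
    then show "fst ?u < fst b" "snd ?u \<le> snd b"
      using block_rows(1)[OF that] fst_corner[of n] by (simp_all add: coeff_part_def)
  qed
  have glue: "card {r \<in> linear_extensions (Sh P w (Suc n)). r \<inter> ?D \<times> ?D = d \<and>
        Q (r \<inter> coeff_part n \<times> coeff_part n)} =
      card {r \<in> linear_extensions (Sh P w n). r \<inter> ?D \<times> ?D = d} *
      card {g \<in> linear_extensions (coeff_part n). g \<inter> ?D \<times> ?D = d \<and> Q g}" for d Q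
  proof (rule card_glue[of ?A ?D ?B ?u d Q, unfolded AD DB, unfolded ADB[unfolded AD]])
    show "finite (Sh P w (Suc n))"
      by (rule Sh_props)
    show "?A \<inter> ?D = {}" "?u \<in> ?D"
      using corner_in_index_part by blast+
    show "?D \<inter> ?B = {}" "?A \<inter> ?B = {}"
      using row_A row_D row_B by fastforce+
    show "(a, ?u) \<in> r" if "r \<in> linear_extensions (Sh P w n)" "a \<in> ?A" for r a
      using linked_less[OF Sh_props(2) that(1)] that(2) row_A[OF that(2)] corner_in_Sh by fastforce
    show "(?u, b) \<in> g" if "g \<in> linear_extensions (coeff_part n)" "b \<in> ?B" for g b
      using linked_less[OF linked_parts(2) that(1), of ?u b] row_B[OF that(2)] that(2)
        corner_in_index_part coeff_part_eq[of n] by fastforce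
    show "a - b \<notin> {(0, 1), (1, 0)}" if "a \<in> ?A" "b \<in> ?B" for a b
      using row_A[OF that(1)] row_B[OF that(2)] by (auto simp: prod_eq_iff)
  qed
  have restr: "r \<inter> coeff_part n \<times> coeff_part n \<inter> ?D' \<times> ?D' = r \<inter> ?D' \<times> ?D'" for r
    using index_part_Suc_subset by blast
  have shift_iff: "shift_rel s r = q \<longleftrightarrow> r = shift_rel (- s) q" for r q
    by (auto simp: shift_rel_shift_rel)
  \<comment> \<open>In \<open>glue\<close>, \<open>d\<close> is the order of \<open>\<xi>\<close>
    moved back onto \<open>?D\<close>, and \<open>Q\<close> prescribes the trace on the new index
    part.\<close>
  have "card {r \<in> linear_extensions (Sh P w (Suc n)). shift_rel s' (r \<inter> ?D' \<times> ?D') = tableau_order \<xi>' \<and>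
        shift_rel s (r \<inter> ?D \<times> ?D) = tableau_order \<xi>} = transfer_count \<xi>' \<xi> * order_count n \<xi>"
    if xi: "\<xi> \<in> SYT (index_shape P w)" for \<xi>
    using glue[of "shift_rel (- s) (tableau_order \<xi>)" "\<lambda>g. shift_rel s' (g \<inter> ?D' \<times> ?D') = tableau_order \<xi>'"]
    unfolding transfer_count_eq[OF n s s' xi xi'] order_count_eq[OF s xi] restr shift_iff
    by (simp only: conj_commute mult.commute)
  moreover have "?D \<subseteq> Sh P w (Suc n)"
    using index_part_subset_Sh Sh_Suc by blast
  ultimately show ?thesis
    unfolding order_count_eq[OF s' xi']
    by (subst card_Collect_linear_extensions_split[OF Sh_props(1) _ s]) simp_all
qed

end

theorem theorem1:
  fixes P :: "cell set" and w n :: nat and ts :: "tableau list"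
  assumes "compatible P w"
    and "distinct ts" and "set ts = SYT (index_shape P w)"
    and "n \<ge> index_N P w"
  shows "real (num_SYT_Sh P w n) =
    ones_vector P w \<bullet>
      ((transfer_matrix P w ts ^\<^sub>m (n - index_N P w)) *\<^sub>v initial_vector P w ts)"
proof -
  interpret compatible_pair P w
    by unfold_locales (rule assms(1))
  let ?N = "index_N P w" and ?d = "index_dim P w" and ?M = "transfer_matrix P w ts"
  have d: "?d = length ts"
    using assms(2,3) by (simp add: index_dim_def distinct_card[symmetric])
  \<comment> \<open>The state vector: at \<open>?N\<close> it is the initial vector, and at
    \<open>n\<close> the sum of its entries counts all tableaux.\<close>
  define v where "v = (\<lambda>k. vec ?d (\<lambda>r. real (order_count k (ts ! r))))"
  have ts: "ts ! i \<in> SYT (index_shape P w)" if "i < ?d" for i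
    using that assms(3) d nth_mem by metis
  have "v (Suc k) = ?M *\<^sub>v v k" if k: "?N \<le> k" for k
  proof
    show "dim_vec (v (Suc k)) = dim_vec (?M *\<^sub>v v k)"
      by (simp add: v_def transfer_matrix_def)
    fix i assume "i < dim_vec (?M *\<^sub>v v k)"
    then have i: "i < ?d"
      by (simp add: transfer_matrix_def)
    have "(?M *\<^sub>v v k) $ i =
        (\<Sum>j\<in>{0..<length ts}. real (transfer_count (ts ! i) (ts ! j) * order_count k (ts ! j)))"
      using i by (simp add: v_def transfer_matrix_def scalar_prod_def transfer_count_def d[symmetric])
    also have "\<dots> = real (\<Sum>\<xi>\<in>SYT (index_shape P w). transfer_count (ts ! i) \<xi> * order_count k \<xi>)"
      unfolding of_nat_sum assms(3)[symmetric]
      by (rule sum_nth_distinct[OF assms(2), of "\<lambda>\<xi>. real (transfer_count (ts ! i) \<xi> * order_count k \<xi>)"])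
    also have "\<dots> = v (Suc k) $ i"
      using order_count_Suc[OF steady_mono[OF steady_index_N k] ts[OF i]] i by (simp add: v_def)
    finally show "v (Suc k) $ i = (?M *\<^sub>v v k) $ i"
      by simp
  qed
  then have "v (?N + (n - ?N)) = ?M ^\<^sub>m (n - ?N) *\<^sub>v v ?N"
    by (intro pow_mat_mult_vec_iterate[of _ ?d]) (simp_all add: v_def transfer_matrix_def)
  moreover have "initial_vector P w ts = v ?N"
    by (simp add: initial_vector_def v_def order_count_def)
  ultimately have "?M ^\<^sub>m (n - ?N) *\<^sub>v initial_vector P w ts = v n"
    using assms(4) by simp
  moreover have "ones_vector P w \<bullet> v n = (\<Sum>j\<in>{0..<length ts}. real (order_count n (ts ! j)))"
    by (simp add: ones_vector_def v_def scalar_prod_def d)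
  moreover have "\<dots> = real (num_SYT_Sh P w n)"
    using sum_nth_distinct[OF assms(2), of "\<lambda>\<xi>. real (order_count n \<xi>)"] assms(3)
      card_SYT_Sh[OF steady_mono[OF steady_index_N assms(4)]]
    by (simp add: num_SYT_Sh_def)
  ultimately show ?thesis
    by simp
qed

end
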